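(* Let $n\geq1$ be an integer, $\sigma\geq1$ and $s\geq0$ real, and let $w$ be the solution of $w_{tt}+(-\Delta)^\sigma w=0$ in $(0,\infty)\times\mathbb{R}^n$, $(w,w_t)(0,\cdot)=(w_0,w_1)$. For $n>2s$ let $$D_{n,\sigma,s}(t):=\begin{cases}t^{1-\frac{n-2s}{2\sigma}}&\text{if } 2s<n<2\sigma+2s,\\ \sqrt{\ln t}&\text{if } n=2\sigma+2s,\\ 1&\text{if } n>2\sigma+2s.\end{cases}$$ (i) If $n>2s$, there are $C,T>0$ depending only on $n,\sigma,s$ such that whenever $w_0\in L^2$ and $\nabla^s w_1\in L^2\cap L^1$, $\|w(t,\cdot)\|_{L^2}\leq C\,D_{n,\sigma,s}(t)\big(\|w_0\|_{L^2}+\|\nabla^s w_1\|_{L^2\cap L^1}\big)$ for $t\geq T$. (ii) If $n>2s$, $w_0\in L^2\cap L^1$, $\nabla^s w_1\in L^2\cap L^{1,1}$ and $P_{\nabla^s w_1}\neq0$, then there are $c,T>0$ independent of $t$ (possibly depending on the data) such that $\|w(t,\cdot)\|_{L^2}\geq c\,D_{n,\sigma,s}(t)\,|P_{\nabla^s w_1}|$ for $t\geq T$. (iii) If $n\leq2s$, $w_0\in L^2$, $\nabla^s w_1\in L^{1,1}$ and $P_{\nabla^s w_1}\neq0$, then $\|w(t,\cdot)\|_{L^2}=+\infty$ for all $t\in(0,t_0]$, for every $t_0>0$.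
   Context: All function spaces are over $\mathbb{R}^n$; $\hat f$ is the Fourier transform. $L^{1,1}:=\{f\in L^1:\|(1+|x|)f\|_{L^1}<\infty\}$; $\|f\|_{X\cap Y}=\|f\|_X+\|f\|_Y$; $P_f:=\int_{\mathbb{R}^n}f\,dx$. For real $s\geq0$, $\nabla^s$ is the Fourier multiplier with symbol $|\xi|^s$: "$\nabla^s w_1\in X$" means that $\hat w_1$ is a measurable function such that $|\xi|^s\hat w_1(\xi)$ is the Fourier transform of a function in $X$, denoted $\nabla^s w_1$. $(-\Delta)^\sigma$ has symbol $|\xi|^{2\sigma}$. The solution is understood through $\hat w(t,\xi)=\cos(|\xi|^\sigma t)\,\hat w_0(\xi)+\frac{\sin(|\xi|^\sigma t)}{|\xi|^\sigma}\hat w_1(\xi)$, and $\|w(t,\cdot)\|_{L^2}\in[0,+\infty]$ is computed by Plancherel. *)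

theory Defs
  imports "HOL-Analysis.Analysis"
begin

text \<open>
  Functions on Euclidean space are complex-valued and Lebesgue measurable; they are not
  identified up to null sets. Norms take values in \<^typ>\<open>ennreal\<close>, so infinite norms are
  meaningful.
\<close>

definition L1_norm :: "('a::euclidean_space \<Rightarrow> complex) \<Rightarrow> ennreal" where
  "L1_norm f = (\<integral>\<^sup>+ x. ennreal (cmod (f x)) \<partial>lebesgue)"

text \<open>The case distinction extends the square root to \<^term>\<open>\<infinity> :: ennreal\<close>.\<close>

definition L2_norm :: "('a::euclidean_space \<Rightarrow> complex) \<Rightarrow> ennreal" where
  "L2_norm f =
     (let I = (\<integral>\<^sup>+ x. ennreal ((cmod (f x))\<^sup>2) \<partial>lebesgue)
      in if I = \<infinity> then \<infinity> else ennreal (sqrt (enn2real I)))"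

definition L1 :: "('a::euclidean_space \<Rightarrow> complex) set" where
  "L1 = {f. f \<in> borel_measurable lebesgue \<and> L1_norm f < \<infinity>}"

definition L2 :: "('a::euclidean_space \<Rightarrow> complex) set" where
  "L2 = {f. f \<in> borel_measurable lebesgue \<and> L2_norm f < \<infinity>}"

definition L11 :: "('a::euclidean_space \<Rightarrow> complex) set" where
  "L11 = {f \<in> L1. L1_norm (\<lambda>x. complex_of_real (1 + norm x) * f x) < \<infinity>}"

definition total_mass :: "('a::euclidean_space \<Rightarrow> complex) \<Rightarrow> complex" where
  "total_mass f = (\<integral>x. f x \<partial>lebesgue)"

definition fourier_L1 :: "('a::euclidean_space \<Rightarrow> complex) \<Rightarrow> 'a \<Rightarrow> complex" where
  "fourier_L1 f \<xi> = (\<integral>x. cis (- (x \<bullet> \<xi>)) * f x \<partial>lebesgue)"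

text \<open>
  The Fourier transform on \<^term>\<open>L2\<close> is the extension by continuity from the intersection of
  \<^term>\<open>L1\<close> and \<^term>\<open>L2\<close>. It is determined only up to null sets, so a representative is chosen.
\<close>

definition has_fourier_L2 ::
    "('a::euclidean_space \<Rightarrow> complex) \<Rightarrow> ('a \<Rightarrow> complex) \<Rightarrow> bool" where
  "has_fourier_L2 f F \<longleftrightarrow> F \<in> L2 \<and>
     (\<exists>\<phi> :: nat \<Rightarrow> 'a \<Rightarrow> complex. (\<forall>k. \<phi> k \<in> L1 \<inter> L2) \<and>
        (\<lambda>k. L2_norm (\<lambda>x. \<phi> k x - f x)) \<longlonglongrightarrow> 0 \<and>
        (\<lambda>k. L2_norm (\<lambda>\<xi>. fourier_L1 (\<phi> k) \<xi> - F \<xi>)) \<longlonglongrightarrow> 0)"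

definition fourier_L2 :: "('a::euclidean_space \<Rightarrow> complex) \<Rightarrow> 'a \<Rightarrow> complex" where
  "fourier_L2 f = (SOME F. has_fourier_L2 f F)"

text \<open>
  A velocity datum $w_1$ is given by its Fourier transform \<open>w1_hat\<close>, which need not be locally
  integrable. \<open>frac_grad s w1_hat g\<close> says that $g$ is $\nabla^s w_1$. The case $g \in L^1$ suffices,
  since every space in which $\nabla^s w_1$ is taken is contained in $L^1$. At the origin
  \<open>powr\<close> is 0 even for \<open>s = 0\<close>, which is immaterial almost everywhere.
\<close>

definition frac_grad ::
    "real \<Rightarrow> ('a::euclidean_space \<Rightarrow> complex) \<Rightarrow> ('a \<Rightarrow> complex) \<Rightarrow> bool" where
  "frac_grad s w1_hat g \<longleftrightarrow>
     w1_hat \<in> borel_measurable lebesgue \<and> g \<in> L1 \<and>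
     (AE \<xi> in lebesgue. complex_of_real (norm \<xi> powr s) * w1_hat \<xi> = fourier_L1 g \<xi>)"

definition wave_hat ::
    "real \<Rightarrow> ('a::euclidean_space \<Rightarrow> complex) \<Rightarrow> ('a \<Rightarrow> complex) \<Rightarrow> real \<Rightarrow> 'a \<Rightarrow> complex" where
  "wave_hat \<sigma> w0 w1_hat t \<xi> =
     complex_of_real (cos (norm \<xi> powr \<sigma> * t)) * fourier_L2 w0 \<xi> +
     complex_of_real (sin (norm \<xi> powr \<sigma> * t) / norm \<xi> powr \<sigma>) * w1_hat \<xi>"

text \<open>The $L^2$ norm of $w(t,\cdot)$; the factor is the Plancherel constant for \<^term>\<open>fourier_L1\<close>.\<close>

definition wave_L2_norm ::
    "real \<Rightarrow> ('a::euclidean_space \<Rightarrow> complex) \<Rightarrow> ('a \<Rightarrow> complex) \<Rightarrow> real \<Rightarrow> ennreal" where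
  "wave_L2_norm \<sigma> w0 w1_hat t =
     ennreal ((2 * pi) powr (- real DIM('a) / 2)) * L2_norm (wave_hat \<sigma> w0 w1_hat t)"

definition growth :: "nat \<Rightarrow> real \<Rightarrow> real \<Rightarrow> real \<Rightarrow> real" where
  "growth n \<sigma> s t =
     (if 2 * s < real n \<and> real n < 2 * \<sigma> + 2 * s then t powr (1 - (real n - 2 * s) / (2 * \<sigma>))
      else if real n = 2 * \<sigma> + 2 * s then sqrt (ln t)
      else 1)"

end

theory Submission
  imports Defs "HOL-Probability.Characteristic_Functions"
begin

text \<open>
  By Plancherel the claim concerns \<open>\<integral> |\<xi>|^(-2\<sigma>-2s) (sin (|\<xi>|^\<sigma> t))^2 |G(\<xi>)|^2 d\<xi>\<close>,
  where \<open>G\<close> is the Fourier transform of $\nabla^s w_1$. For high frequencies this is at most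
  \<open>\<integral> |G|^2\<close>. For \<open>|\<xi>| \<le> 1\<close> one has \<open>|G| \<le> \<parallel>\<nabla>^s w_1\<parallel>_1\<close>, and the remaining
  radial integral, split at \<open>|\<xi>| = t^(-1/\<sigma>)\<close>, grows like the square of $D_{n,\sigma,s}(t)$.
  For the lower bounds, \<open>|G| \<ge> |P|/2\<close> near the origin by the weighted integrability,
  so that there the singular factor \<open>|\<xi>|^(-\<sigma>-s)\<close> makes the velocity term dominate the bounded
  transform of \<open>w0\<close>, except where the sine is small. It remains to bound the integral of
  \<open>max 0 ((sin (r^\<sigma> t))^2 / 2 - 1/16) / r\<close> over an interval from below.
  In case (iii) the integrand is bounded below by a multiple of \<open>|\<xi>|^(-2s)\<close> near the
  origin, which is not integrable.
\<close>

subsection \<open>Gaussians and the Bessel inequality\<close>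

text \<open>The norm of the solution is taken on the Fourier side, so only the inequality half of
  Plancherel's identity is used, up to a constant and for the data alone. It must come with
  existence of the transform on \<open>L2\<close>: \<open>fourier_L2\<close> is a bare choice, about
  which nothing is known until some admissible transform has been exhibited. In the lower bounds the
  obstacle is that near the zeros of the sine the velocity term cannot beat the transform of
  \<open>w0\<close>, and these zeros move with \<open>t\<close>. Hence the estimate has to hold on
  average. Subtracting 1/16 pays for the bad set, and the mean 1/4 - 1/16 = 3/16 is still positive.
  In polar coordinates the weight is \<open>r\<close> to the power n - 2\<sigma> - 2s against
  \<open>dr / r\<close>, and on this logarithmic scale one averaging estimate serves all growth
  rates; they differ only in the choice of the shell where it is applied. For infinite norms
  \<open>t\<close> is fixed, and close enough to the origin the sine no longer oscillates.\<close>

lemma sigma_finite_lebesgue: "sigma_finite_measure (lebesgue :: 'a::euclidean_space measure)"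
proof -
  obtain A :: "'a set set" where "countable A" "A \<subseteq> sets lborel" "\<Union>A = space lborel"
      "\<forall>a\<in>A. emeasure lborel a \<noteq> \<infinity>"
    using sigma_finite_lborel[where 'a='a] by (auto simp: sigma_finite_measure_def)
  then show ?thesis
    by (intro sigma_finite_measure.intro exI[of _ A]) (auto intro!: sets_completionI_sets)
qed

lemma L1_iff_integrable: "f \<in> L1 \<longleftrightarrow> integrable lebesgue f"
  by (auto simp: L1_def L1_norm_def integrable_iff_bounded)

text \<open>The substitution \<open>u = sqrt \<epsilon> * x\<close> turns the integral into the
  characteristic function of the standard normal law at
  \<open>- z / sqrt \<epsilon>\<close>.\<close>

lemma gaussian_fourier_real:
  fixes z \<epsilon> :: real
  assumes "\<epsilon> > 0"
  shows "integrable lborel (\<lambda>x. cis (- (z * x)) * of_real (exp (- \<epsilon> * x\<^sup>2 / 2)))"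
    and "(\<integral>x. cis (- (z * x)) * of_real (exp (- \<epsilon> * x\<^sup>2 / 2)) \<partial>lborel)
           = of_real (sqrt (2 * pi / \<epsilon>) * exp (- z\<^sup>2 / (2 * \<epsilon>)))"
proof -
  define c where "c = sqrt \<epsilon>"
  have c: "c > 0" "c\<^sup>2 = \<epsilon>" using assms by (auto simp: c_def)
  define h where "h = (\<lambda>u. cis (- (z / c) * u) * of_real (std_normal_density u))"
  have h_int: "integrable lborel h"
  proof (rule Bochner_Integration.integrable_bound)
    show "integrable lborel std_normal_density" by simp
    show "h \<in> borel_measurable lborel" unfolding h_def cis_conv_exp by measurable
  qed (auto simp: h_def norm_mult)
  have "(\<integral>u. h u \<partial>lborel) = char std_normal_distribution (- (z / c))"
    unfolding char_def h_def
    by (subst integral_density) (auto simp: cis_conv_exp scaleR_conv_of_real mult.commute)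
  also have "\<dots> = of_real (exp (- (z\<^sup>2 / (2 * \<epsilon>))))"
    using c by (simp add: char_std_normal_distribution power_divide divide_simps)
  finally have h_val: "(\<integral>u. h u \<partial>lborel) = of_real (exp (- (z\<^sup>2 / (2 * \<epsilon>))))" .
  \<comment> \<open>The summand 0 gives the argument the affine form that the substitution rule for
    \<open>lborel\<close> expects.\<close>
  have eq: "cis (- (z * x)) * of_real (exp (- \<epsilon> * x\<^sup>2 / 2)) = of_real (sqrt (2 * pi)) * h (0 + c * x)" for x
    using c by (simp add: h_def std_normal_density_def power_mult_distrib)
  show "integrable lborel (\<lambda>x. cis (- (z * x)) * of_real (exp (- \<epsilon> * x\<^sup>2 / 2)))"
    unfolding eq using lborel_integrable_real_affine[OF h_int, of c 0] c
    by (intro integrable_mult_right) auto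
  have "(\<integral>x. h x \<partial>lborel) = of_real c * (\<integral>x. h (0 + c * x) \<partial>lborel)"
    using lborel_integral_real_affine[of c h 0] c by (simp add: scaleR_conv_of_real)
  then have "(\<integral>x. h (0 + c * x) \<partial>lborel) = of_real (exp (- (z\<^sup>2 / (2 * \<epsilon>))) / c)"
    using c h_val by (simp add: field_simps)
  then show "(\<integral>x. cis (- (z * x)) * of_real (exp (- \<epsilon> * x\<^sup>2 / 2)) \<partial>lborel)
           = of_real (sqrt (2 * pi / \<epsilon>) * exp (- z\<^sup>2 / (2 * \<epsilon>)))"
    unfolding eq using c by (simp add: real_sqrt_divide real_sqrt_mult c_def)
qed

text \<open>\<open>lborel\<close> is the image of the product of one-dimensional measures under the
  map that assembles a vector from its coordinates, so a product of functions of single coordinates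
  factorizes.\<close>

lemma
  fixes f :: "'a::euclidean_space \<Rightarrow> real \<Rightarrow> complex"
  assumes "\<And>b. b \<in> Basis \<Longrightarrow> integrable lborel (f b)"
  shows integrable_lborel_prod: "integrable lborel (\<lambda>x. \<Prod>b\<in>Basis. f b (x \<bullet> b))" (is ?A)
    and integral_lborel_prod:
      "(\<integral>x. (\<Prod>b\<in>Basis. f b (x \<bullet> b)) \<partial>lborel) = (\<Prod>b\<in>Basis. \<integral>x. f b x \<partial>lborel)" (is ?B)
proof -
  interpret product_sigma_finite "\<lambda>_::'a. lborel :: real measure"
    by (simp add: product_sigma_finite_def sigma_finite_lborel)
  have [measurable]: "f b \<in> borel_measurable borel" if "b \<in> Basis" for b
    using borel_measurable_integrable[OF assms[OF that]] by simp
  have *: "(\<Prod>b\<in>Basis. f b ((\<Sum>b\<in>Basis. x b *\<^sub>R b) \<bullet> b)) = (\<Prod>b\<in>Basis. f b (x b))" for x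
    by (intro prod.cong) (auto simp: inner_sum_left inner_Basis if_distrib cong: if_cong)
  have T: "(\<lambda>f. \<Sum>b\<in>Basis. f b *\<^sub>R b) \<in> (\<Pi>\<^sub>M b\<in>Basis. lborel) \<rightarrow>\<^sub>M (borel :: 'a measure)"
    by measurable
  have M: "(\<lambda>x::'a. \<Prod>b\<in>Basis. f b (x \<bullet> b)) \<in> borel_measurable borel"
    by measurable
  show ?A
    apply (subst lborel_eq)
    apply (subst integrable_distr_eq[OF T M])
    unfolding * using assms by (intro product_integrable_prod) auto
  show ?B
    apply (subst lborel_eq)
    apply (subst integral_distr[OF T M])
    unfolding * using assms by (intro product_integral_prod) auto
qed

lemma cis_sum: "finite A \<Longrightarrow> cis (\<Sum>i\<in>A. f i) = (\<Prod>i\<in>A. cis (f i))"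
  by (induction rule: finite_induct) (auto simp: cis_mult[symmetric])

text \<open>Both \<open>z \<bullet> x\<close> and the squared norm are sums over coordinates, so
  phase and weight split into one-dimensional factors.\<close>

lemma gaussian_fourier:
  fixes z :: "'a::euclidean_space"
  assumes "\<epsilon> > 0"
  shows "integrable lebesgue (\<lambda>x. cis (- (z \<bullet> x)) * of_real (exp (- \<epsilon> * (norm x)\<^sup>2 / 2)))" (is ?A)
    and "(\<integral>x. cis (- (z \<bullet> x)) * of_real (exp (- \<epsilon> * (norm x)\<^sup>2 / 2)) \<partial>lebesgue)
           = of_real (sqrt (2 * pi / \<epsilon>) ^ DIM('a) * exp (- (norm z)\<^sup>2 / (2 * \<epsilon>)))" (is ?B)
proof -
  let ?f = "\<lambda>b x. cis (- ((z \<bullet> b) * x)) * of_real (exp (- \<epsilon> * x\<^sup>2 / 2)) :: complex"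
  have norm2: "(norm x)\<^sup>2 = (\<Sum>b\<in>Basis. (x \<bullet> b)\<^sup>2)" for x :: 'a
    by (simp add: power2_norm_eq_inner euclidean_inner[of x x] power2_eq_square[of "x \<bullet> _"])
  have eq: "cis (- (z \<bullet> x)) * of_real (exp (- \<epsilon> * (norm x)\<^sup>2 / 2)) = (\<Prod>b\<in>Basis. ?f b (x \<bullet> b))"
    for x :: 'a
  proof -
    have "- (z \<bullet> x) = (\<Sum>b\<in>Basis. - ((z \<bullet> b) * (x \<bullet> b)))"
      by (subst euclidean_inner) (simp add: sum_negf)
    then have "cis (- (z \<bullet> x)) = (\<Prod>b\<in>Basis. cis (- ((z \<bullet> b) * (x \<bullet> b))))"
      by (simp only: cis_sum[OF finite_Basis])
    moreover have "exp (- \<epsilon> * (norm x)\<^sup>2 / 2) = (\<Prod>b\<in>Basis. exp (- \<epsilon> * (x \<bullet> b)\<^sup>2 / 2))"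
      by (simp add: norm2 exp_sum[symmetric] sum_distrib_left sum_divide_distrib sum_negf)
    ultimately show ?thesis by (simp only: prod.distrib of_real_prod)
  qed
  have int: "integrable lborel (?f b)" for b
    by (rule gaussian_fourier_real[OF assms])
  have m: "(\<lambda>x. \<Prod>b\<in>Basis. ?f b (x \<bullet> b)) \<in> borel_measurable (lborel :: 'a measure)"
    by (rule borel_measurable_integrable[OF integrable_lborel_prod[OF int]])
  show ?A unfolding eq by (subst integrable_completion[OF m]) (rule integrable_lborel_prod[OF int])
  have "(\<Prod>b\<in>Basis. of_real (sqrt (2 * pi / \<epsilon>) * exp (- (z \<bullet> b)\<^sup>2 / (2 * \<epsilon>))) :: complex)
      = of_real (sqrt (2 * pi / \<epsilon>) ^ DIM('a) * exp (- (norm z)\<^sup>2 / (2 * \<epsilon>)))"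
    by (simp add: norm2 of_real_prod[symmetric] prod.distrib exp_sum[symmetric] sum_divide_distrib sum_negf
        del: of_real_prod)
  then show ?B unfolding eq
    by (subst integral_completion[OF m]) (simp only: integral_lborel_prod[OF int] gaussian_fourier_real[OF assms])
qed

text \<open>Frequency zero of \<open>gaussian_fourier\<close>, with \<open>1 / \<epsilon>\<close> in
  place of \<open>\<epsilon>\<close>, combined with translation invariance. It yields the mass of
  the kernel in \<open>bessel_gaussian\<close>.\<close>

lemma nn_integral_gaussian:
  assumes "\<epsilon> > 0"
  shows "(\<integral>\<^sup>+x. ennreal (exp (- (norm (x - y :: 'a::euclidean_space))\<^sup>2 / (2 * \<epsilon>))) \<partial>lebesgue)
           = ennreal (sqrt (2 * pi * \<epsilon>) ^ DIM('a))"
proof -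
  let ?g = "\<lambda>x::'a. exp (- (1 / \<epsilon>) * (norm x)\<^sup>2 / 2)"
  have c: "integrable lebesgue (\<lambda>x. complex_of_real (?g x))"
    using gaussian_fourier(1)[of "1 / \<epsilon>" "0::'a"] assms by simp
  have "complex_of_real (\<integral>x. ?g x \<partial>lebesgue) = of_real (sqrt (2 * pi * \<epsilon>) ^ DIM('a))"
    using gaussian_fourier(2)[of "1 / \<epsilon>" "0::'a"] assms
    by (simp add: integral_complex_of_real del: of_real_power)
  then have v: "(\<integral>x. ?g x \<partial>lebesgue) = sqrt (2 * pi * \<epsilon>) ^ DIM('a)"
    by (simp only: of_real_eq_iff)
  have "(\<integral>\<^sup>+x. ennreal (exp (- (norm (x - y))\<^sup>2 / (2 * \<epsilon>))) \<partial>lebesgue) = (\<integral>\<^sup>+x. ennreal (?g (-y + x)) \<partial>lborel)"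
    by (simp add: nn_integral_completion mult.commute)
  also have "\<dots> = (\<integral>\<^sup>+x. ennreal (?g x) \<partial>distr lborel borel ((+) (- y)))"
    by (subst nn_integral_distr) (auto)
  also have "\<dots> = (\<integral>\<^sup>+x. ennreal (?g x) \<partial>lebesgue)"
    by (simp add: nn_integral_completion lborel_distr_plus)
  also have "\<dots> = ennreal (\<integral>x. ?g x \<partial>lebesgue)"
    using integrable_Re[OF c] by (intro nn_integral_eq_integral) (auto)
  finally show ?thesis using v by simp
qed

section \<open>Phases under the integral and the Bessel inequality\<close>

lemma cis_borel [measurable (raw)]: "f \<in> borel_measurable M \<Longrightarrow> (\<lambda>x. cis (f x)) \<in> borel_measurable M"
  unfolding cis_conv_exp by measurable

text \<open>The integrability fact behind the uses of Fubini in \<open>bessel_gaussian\<close>: a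
  bounded phase times a product of separately integrable functions. There it is applied to pairs
  and, with a pair as first component, to triples.\<close>

lemma (in pair_sigma_finite) integrable_mult_pair:
  fixes f :: "'a \<Rightarrow> complex" and g :: "'b \<Rightarrow> complex"
  assumes f: "integrable M1 f" and g: "integrable M2 g"
    and c: "c \<in> borel_measurable (M1 \<Otimes>\<^sub>M M2)" "\<And>p. cmod (c p) \<le> 1"
  shows "integrable (M1 \<Otimes>\<^sub>M M2) (\<lambda>p. c p * (f (fst p) * g (snd p)))"
proof -
  have [measurable]: "f \<in> borel_measurable M1" "g \<in> borel_measurable M2" using f g by auto
  have "integrable (M1 \<Otimes>\<^sub>M M2) (\<lambda>p. f (fst p) * g (snd p))"
    using f g by (intro Fubini_integrable) (auto simp: norm_mult)
  then show ?thesis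
    using c by (elim Bochner_Integration.integrable_bound) (auto simp: norm_mult intro!: mult_left_le_one_le)
qed

lemma norm_integral_cis_le:
  "cmod (\<integral>x. cis (h x) * f x \<partial>M) \<le> (\<integral>x. cmod (f x) \<partial>M)"
\<comment> \<open>In the other case the left integral has its default value 0.\<close>
proof (cases "integrable M (\<lambda>x. cis (h x) * f x)")
  case True
  have "cmod (\<integral>x. cis (h x) * f x \<partial>M) \<le> (\<integral>x. cmod (cis (h x) * f x) \<partial>M)" by simp
  then show ?thesis by (simp add: norm_mult)
qed (simp add: not_integrable_integral_eq)

lemma id_borel_lebesgue [measurable]: "(\<lambda>x. x) \<in> borel_measurable (lebesgue :: 'a::euclidean_space measure)"
  by (rule measurable_completion) simp

lemma fourier_L1_measurable [measurable]:
  fixes f :: "'a::euclidean_space \<Rightarrow> complex"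
  assumes "f \<in> L1"
  shows "fourier_L1 f \<in> borel_measurable lebesgue"
proof -
  interpret sigma_finite_measure "lebesgue :: 'a measure" by (rule sigma_finite_lebesgue)
  have [measurable]: "f \<in> borel_measurable lebesgue" using assms by (simp add: L1_def)
  show ?thesis unfolding fourier_L1_def by measurable
qed

text \<open>
  Inserting the Gaussian weight makes Fubini applicable: the weighted square integral of the
  transform becomes \<open>\<integral>\<integral> f(x) cnj (f(y)) G(x - y) dx dy\<close> with a Gaussian \<open>G \<ge> 0\<close> of total mass
  \<open>(2\<pi>)^n\<close>, and \<open>|f(x) f(y)| \<le> (|f(x)|^2 + |f(y)|^2) / 2\<close> finishes the estimate.
\<close>

lemma bessel_gaussian:
  fixes f :: "'a::euclidean_space \<Rightarrow> complex"
  assumes f: "f \<in> L1" and e: "\<epsilon> > 0"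
  shows "(\<integral>\<^sup>+\<xi>. ennreal (exp (- \<epsilon> * (norm \<xi>)\<^sup>2 / 2) * (cmod (fourier_L1 f \<xi>))\<^sup>2) \<partial>lebesgue)
      \<le> ennreal ((2 * pi) ^ DIM('a)) * (\<integral>\<^sup>+x. ennreal ((cmod (f x))\<^sup>2) \<partial>lebesgue)"
proof -
  let ?L = "lebesgue :: 'a measure"
  define \<phi> where "\<phi> = (\<lambda>\<xi>::'a. exp (- \<epsilon> * (norm \<xi>)\<^sup>2 / 2))"
  define G where "G = (\<lambda>z::'a. sqrt (2 * pi / \<epsilon>) ^ DIM('a) * exp (- (norm z)\<^sup>2 / (2 * \<epsilon>)))"
  define u where "u = (\<lambda>p. f (fst p) * cnj (f (snd p)))"
  interpret S: sigma_finite_measure ?L by (rule sigma_finite_lebesgue)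
  interpret P: pair_sigma_finite ?L ?L ..
  interpret Q: pair_sigma_finite "?L \<Otimes>\<^sub>M ?L" ?L ..
  have fi: "integrable ?L f" using f by (simp add: L1_iff_integrable)
  then have [measurable]: "f \<in> borel_measurable ?L" by auto
  have fi': "integrable ?L (\<lambda>x. cnj (f x))" using fi by simp
  have phii: "integrable ?L (\<lambda>x. complex_of_real (\<phi> x))"
    using gaussian_fourier(1)[OF e, of 0] by (simp add: \<phi>_def)
  then have phir: "integrable ?L \<phi>" using integrable_Re[OF phii] by simp
  have [measurable]: "\<phi> \<in> borel_measurable ?L" using phir by auto
  have ui: "integrable (?L \<Otimes>\<^sub>M ?L) u"
    using P.integrable_mult_pair[OF fi fi', of "\<lambda>_. 1"] by (simp add: u_def)
  have [measurable]: "fourier_L1 f \<in> borel_measurable ?L" by (rule fourier_L1_measurable[OF f])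
  \<comment> \<open>The squared modulus is the transform times its conjugate; conjugation flips the
    phase of the second variable, which is why only \<open>x - y\<close> occurs.\<close>
  have prod: "(\<integral>p. cis (- ((fst p - snd p) \<bullet> \<xi>)) * u p \<partial>(?L \<Otimes>\<^sub>M ?L)) = of_real ((cmod (fourier_L1 f \<xi>))\<^sup>2)" for \<xi>
  proof -
    have split: "cis (- ((x - y) \<bullet> \<xi>)) = cis (- (x \<bullet> \<xi>)) * cis (y \<bullet> \<xi>)" for x y
      by (simp add: cis_mult inner_diff_left)
    have "(\<integral>p. cis (- ((fst p - snd p) \<bullet> \<xi>)) * u p \<partial>(?L \<Otimes>\<^sub>M ?L))
        = (\<integral>x. (\<integral>y. cis (- ((x - y) \<bullet> \<xi>)) * u (x, y) \<partial>?L) \<partial>?L)"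
      unfolding u_def
      by (subst P.integral_fst'[symmetric]) (auto intro!: P.integrable_mult_pair fi fi')
    also have "\<dots> = (\<integral>x. (\<integral>y. (cis (- (x \<bullet> \<xi>)) * f x) * cnj (cis (- (y \<bullet> \<xi>)) * f y) \<partial>?L) \<partial>?L)"
      by (intro Bochner_Integration.integral_cong refl)
        (simp add: u_def split cis_cnj)
    also have "\<dots> = fourier_L1 f \<xi> * cnj (fourier_L1 f \<xi>)"
      unfolding fourier_L1_def by (simp only: integral_mult_right_zero integral_mult_left_zero Bochner_Integration.integral_cnj)
    finally show ?thesis by (simp only: complex_norm_square)
  qed
  \<comment> \<open>Here the weight is essential: without \<open>\<phi>\<close> the variable
    \<open>\<xi>\<close> would contribute infinite mass.\<close>
  have int3: "integrable ((?L \<Otimes>\<^sub>M ?L) \<Otimes>\<^sub>M ?L)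
      (\<lambda>q. cis (- ((fst (fst q) - snd (fst q)) \<bullet> snd q)) * (u (fst q) * complex_of_real (\<phi> (snd q))))"
    by (rule Q.integrable_mult_pair[OF ui phii]) auto
  define S where "S = (\<integral>\<xi>. complex_of_real (\<phi> \<xi> * (cmod (fourier_L1 f \<xi>))\<^sup>2) \<partial>?L)"
  have "S = (\<integral>\<xi>. (\<integral>p. cis (- ((fst p - snd p) \<bullet> \<xi>)) * (u p * complex_of_real (\<phi> \<xi>)) \<partial>(?L \<Otimes>\<^sub>M ?L)) \<partial>?L)"
    unfolding S_def of_real_mult prod[symmetric]
    by (intro Bochner_Integration.integral_cong refl)
       (simp add: mult.assoc[symmetric] mult.commute[of "complex_of_real (\<phi> _)"])
  also have "\<dots> = (\<integral>p. (\<integral>\<xi>. cis (- ((fst p - snd p) \<bullet> \<xi>)) * (u p * complex_of_real (\<phi> \<xi>)) \<partial>?L) \<partial>(?L \<Otimes>\<^sub>M ?L))"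
    by (rule Q.Fubini_integral) (use int3 in \<open>simp only: case_prod_beta'\<close>)
  also have "\<dots> = (\<integral>p. u p * complex_of_real (G (fst p - snd p)) \<partial>(?L \<Otimes>\<^sub>M ?L))"
  proof (intro Bochner_Integration.integral_cong refl)
    fix p :: "'a \<times> 'a"
    have "(\<integral>\<xi>. cis (- ((fst p - snd p) \<bullet> \<xi>)) * (u p * complex_of_real (\<phi> \<xi>)) \<partial>?L)
        = (\<integral>\<xi>. u p * (cis (- ((fst p - snd p) \<bullet> \<xi>)) * complex_of_real (\<phi> \<xi>)) \<partial>?L)"
      by (intro Bochner_Integration.integral_cong refl) (simp add: ac_simps)
    also have "\<dots> = u p * complex_of_real (G (fst p - snd p))"
      using gaussian_fourier(2)[OF e, of "fst p - snd p"]
      by (simp add: \<phi>_def G_def del: of_real_mult of_real_power)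
    finally show "(\<integral>\<xi>. cis (- ((fst p - snd p) \<bullet> \<xi>)) * (u p * complex_of_real (\<phi> \<xi>)) \<partial>?L)
        = u p * complex_of_real (G (fst p - snd p))" .
  qed
  finally have S_eq: "S = (\<integral>p. u p * complex_of_real (G (fst p - snd p)) \<partial>(?L \<Otimes>\<^sub>M ?L))" .
  have G0: "G z \<ge> 0" for z using e by (simp add: G_def)
  have Gsym: "G (x - y) = G (y - x)" for x y by (simp add: G_def norm_minus_commute)
  have [measurable]: "G \<in> borel_measurable borel" unfolding G_def by measurable
  \<comment> \<open>The mass is the same for every \<open>\<epsilon>\<close>, because the two square
    roots multiply to \<open>2 * pi\<close>. This uniformity allows the limit taken in
    \<open>bessel\<close>.\<close>
  have Gint: "(\<integral>\<^sup>+x. ennreal (G (x - y)) \<partial>?L) = ennreal ((2 * pi) ^ DIM('a))" for y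
  proof -
    have "(\<integral>\<^sup>+x. ennreal (G (x - y)) \<partial>?L)
      = ennreal (sqrt (2 * pi / \<epsilon>) ^ DIM('a)) * (\<integral>\<^sup>+x. ennreal (exp (- (norm (x - y))\<^sup>2 / (2 * \<epsilon>))) \<partial>?L)"
      unfolding G_def using e by (subst nn_integral_cmult[symmetric]) (auto simp: ennreal_mult)
    also have "\<dots> = ennreal ((sqrt (2 * pi / \<epsilon>) * sqrt (2 * pi * \<epsilon>)) ^ DIM('a))"
      unfolding nn_integral_gaussian[OF e] using e by (simp add: ennreal_mult power_mult_distrib)
    also have "sqrt (2 * pi / \<epsilon>) * sqrt (2 * pi * \<epsilon>) = 2 * pi"
      using e real_sqrt_unique[of "2 * pi" "(2 * pi / \<epsilon>) * (2 * pi * \<epsilon>)"]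
      by (simp add: power2_eq_square real_sqrt_mult[symmetric])
    finally show ?thesis .
  qed
  let ?I = "\<integral>\<^sup>+x. ennreal ((cmod (f x))\<^sup>2) \<partial>?L"
  let ?c = "ennreal ((2 * pi) ^ DIM('a))"
  have a1: "(\<integral>\<^sup>+p. ennreal ((cmod (f (fst p)))\<^sup>2) * ennreal (G (fst p - snd p)) \<partial>(?L \<Otimes>\<^sub>M ?L)) = ?c * ?I"
  proof -
    have "(\<integral>\<^sup>+p. ennreal ((cmod (f (fst p)))\<^sup>2) * ennreal (G (fst p - snd p)) \<partial>(?L \<Otimes>\<^sub>M ?L))
      = (\<integral>\<^sup>+x. (\<integral>\<^sup>+y. ennreal ((cmod (f x))\<^sup>2) * ennreal (G (y - x)) \<partial>?L) \<partial>?L)"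
      by (subst S.nn_integral_fst[symmetric]) (auto simp: Gsym)
    also have "\<dots> = (\<integral>\<^sup>+x. ?c * ennreal ((cmod (f x))\<^sup>2) \<partial>?L)"
      by (intro nn_integral_cong, subst nn_integral_cmult) (auto simp: Gint mult.commute)
    finally show ?thesis by (simp add: nn_integral_cmult)
  qed
  have a2: "(\<integral>\<^sup>+p. ennreal ((cmod (f (snd p)))\<^sup>2) * ennreal (G (fst p - snd p)) \<partial>(?L \<Otimes>\<^sub>M ?L)) = ?c * ?I"
  proof -
    have "(\<integral>\<^sup>+p. ennreal ((cmod (f (snd p)))\<^sup>2) * ennreal (G (fst p - snd p)) \<partial>(?L \<Otimes>\<^sub>M ?L))
      = (\<integral>\<^sup>+y. (\<integral>\<^sup>+x. ennreal ((cmod (f y))\<^sup>2) * ennreal (G (x - y)) \<partial>?L) \<partial>?L)"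
      by (subst P.nn_integral_snd[symmetric]) (auto simp: case_prod_beta)
    also have "\<dots> = (\<integral>\<^sup>+x. ?c * ennreal ((cmod (f x))\<^sup>2) \<partial>?L)"
      by (intro nn_integral_cong, subst nn_integral_cmult) (auto simp: Gint mult.commute)
    finally show ?thesis by (simp add: nn_integral_cmult)
  qed
  have "(\<integral>\<^sup>+\<xi>. ennreal (\<phi> \<xi> * (cmod (fourier_L1 f \<xi>))\<^sup>2) \<partial>?L) = ennreal (\<integral>\<xi>. \<phi> \<xi> * (cmod (fourier_L1 f \<xi>))\<^sup>2 \<partial>?L)"
  proof (rule nn_integral_eq_integral)
    have b: "cmod (fourier_L1 f \<xi>) \<le> (\<integral>x. cmod (f x) \<partial>?L)" for \<xi>
      unfolding fourier_L1_def by (rule norm_integral_cis_le)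
    show "integrable ?L (\<lambda>\<xi>. \<phi> \<xi> * (cmod (fourier_L1 f \<xi>))\<^sup>2)"
      by (rule Bochner_Integration.integrable_bound[OF integrable_mult_left[OF phir, of "(\<integral>x. cmod (f x) \<partial>?L)\<^sup>2"]])
        (auto simp: \<phi>_def intro!: mult_left_mono power_mono b)
  qed (auto simp: \<phi>_def)
  also have "\<dots> = ennreal (cmod S)"
    by (auto simp: S_def integral_complex_of_real \<phi>_def simp del: of_real_mult of_real_power intro!: arg_cong[of _ _ ennreal] abs_of_nonneg[symmetric])
  also have "\<dots> \<le> (\<integral>\<^sup>+p. ennreal (cmod (u p * complex_of_real (G (fst p - snd p)))) \<partial>(?L \<Otimes>\<^sub>M ?L))"
    unfolding S_eq
  proof (rule integral_norm_bound_ennreal)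
    show "integrable (?L \<Otimes>\<^sub>M ?L) (\<lambda>p. u p * complex_of_real (G (fst p - snd p)))"
    proof (rule Bochner_Integration.integrable_bound[OF integrable_mult_left[OF ui, of "complex_of_real (G 0)"]])
      show "(\<lambda>p. u p * complex_of_real (G (fst p - snd p))) \<in> borel_measurable (?L \<Otimes>\<^sub>M ?L)"
        using borel_measurable_integrable[OF ui] by measurable
      have "G z \<le> G 0" for z using e by (auto simp: G_def intro!: mult_left_le)
      then show "AE p in ?L \<Otimes>\<^sub>M ?L. cmod (u p * complex_of_real (G (fst p - snd p))) \<le> cmod (u p * complex_of_real (G 0))"
        using G0 by (auto simp: norm_mult intro!: mult_left_mono)
    qed
  qed
  also have "\<dots> \<le> (\<integral>\<^sup>+p. ennreal (1/2) * (ennreal ((cmod (f (fst p)))\<^sup>2) * ennreal (G (fst p - snd p))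
        + ennreal ((cmod (f (snd p)))\<^sup>2) * ennreal (G (fst p - snd p))) \<partial>(?L \<Otimes>\<^sub>M ?L))"
  proof (rule nn_integral_mono)
    fix p :: "'a \<times> 'a"
    have "2 * (cmod (f (fst p)) * cmod (f (snd p))) \<le> (cmod (f (fst p)))\<^sup>2 + (cmod (f (snd p)))\<^sup>2"
      using sum_squares_bound[of "cmod (f (fst p))" "cmod (f (snd p))"] by simp
    then have "cmod (f (fst p)) * cmod (f (snd p)) * G (fst p - snd p)
       \<le> (1/2 * ((cmod (f (fst p)))\<^sup>2 + (cmod (f (snd p)))\<^sup>2)) * G (fst p - snd p)"
      by (intro mult_right_mono G0) simp
    then have "cmod (u p * complex_of_real (G (fst p - snd p)))
       \<le> 1/2 * ((cmod (f (fst p)))\<^sup>2 * G (fst p - snd p) + (cmod (f (snd p)))\<^sup>2 * G (fst p - snd p))"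
      using G0 by (simp add: u_def norm_mult algebra_simps)
    then have "ennreal (cmod (u p * complex_of_real (G (fst p - snd p)))) \<le> ennreal (1/2 *
        ((cmod (f (fst p)))\<^sup>2 * G (fst p - snd p) + (cmod (f (snd p)))\<^sup>2 * G (fst p - snd p)))"
      by (rule ennreal_leI)
    also have "\<dots> = ennreal (1/2) * (ennreal ((cmod (f (fst p)))\<^sup>2) * ennreal (G (fst p - snd p))
        + ennreal ((cmod (f (snd p)))\<^sup>2) * ennreal (G (fst p - snd p)))"
      using G0 by (subst ennreal_mult) (auto simp: ennreal_mult)
    finally show "ennreal (cmod (u p * complex_of_real (G (fst p - snd p)))) \<le>
      ennreal (1/2) * (ennreal ((cmod (f (fst p)))\<^sup>2) * ennreal (G (fst p - snd p))
        + ennreal ((cmod (f (snd p)))\<^sup>2) * ennreal (G (fst p - snd p)))" .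
  qed
  also have "\<dots> = ennreal (1/2) * (?c * ?I + ?c * ?I)"
    by (subst nn_integral_cmult) (auto simp: nn_integral_add a1 a2)
  also have "\<dots> = ?c * ?I"
  proof -
    have "ennreal (1/2) * ennreal 2 = ennreal (1/2 * 2)" by (rule ennreal_mult[symmetric]) auto
    then have "(ennreal (1/2) * 2) * (?c * ?I) = ?c * ?I" by simp
    then show ?thesis by (simp only: mult_2[symmetric] mult.assoc)
  qed
  finally show ?thesis by (simp add: \<phi>_def)
qed

text \<open>The bound in \<open>bessel_gaussian\<close> does not depend on
  \<open>\<epsilon>\<close>, so the weight is removed by Fatou's lemma along
  \<open>\<epsilon> = 1 / (k + 1)\<close>.\<close>

lemma bessel:
  fixes f :: "'a::euclidean_space \<Rightarrow> complex"
  assumes f: "f \<in> L1"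
  shows "(\<integral>\<^sup>+\<xi>. ennreal ((cmod (fourier_L1 f \<xi>))\<^sup>2) \<partial>lebesgue)
      \<le> ennreal ((2 * pi) ^ DIM('a)) * (\<integral>\<^sup>+x. ennreal ((cmod (f x))\<^sup>2) \<partial>lebesgue)" (is "?A \<le> ?B")
proof -
  define h where "h = (\<lambda>k \<xi>. ennreal (exp (- (1 / real (Suc k)) * (norm (\<xi>::'a))\<^sup>2 / 2) * (cmod (fourier_L1 f \<xi>))\<^sup>2))"
  have [measurable]: "fourier_L1 f \<in> borel_measurable lebesgue" by (rule fourier_L1_measurable[OF f])
  have lim: "(\<lambda>k. h k \<xi>) \<longlonglongrightarrow> ennreal ((cmod (fourier_L1 f \<xi>))\<^sup>2)" for \<xi>
  proof -
    have "(\<lambda>k. exp (- (1 / real (Suc k)) * (norm \<xi>)\<^sup>2 / 2) * (cmod (fourier_L1 f \<xi>))\<^sup>2)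
      \<longlonglongrightarrow> exp (- 0 * (norm \<xi>)\<^sup>2 / 2) * (cmod (fourier_L1 f \<xi>))\<^sup>2"
      using LIMSEQ_inverse_real_of_nat by (intro tendsto_intros) (auto simp: inverse_eq_divide)
    then show ?thesis unfolding h_def by (intro tendsto_ennrealI) simp
  qed
  have "?A = (\<integral>\<^sup>+\<xi>. liminf (\<lambda>k. h k \<xi>) \<partial>lebesgue)"
    by (intro nn_integral_cong) (simp add: lim_imp_Liminf[OF _ lim])
  also have "\<dots> \<le> liminf (\<lambda>k. \<integral>\<^sup>+\<xi>. h k \<xi> \<partial>lebesgue)"
    by (rule nn_integral_liminf) (simp add: h_def)
  also have "\<dots> \<le> ?B"
    unfolding h_def by (intro Liminf_le always_eventually allI bessel_gaussian[OF f]) simp_all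
  finally show ?thesis .
qed

subsection \<open>The Fourier transform on square integrable functions\<close>

text \<open>The square of \<open>L2_norm\<close>, free of the root and of the case distinction at
  infinity, so that monotone integration, Fatou and dominated convergence apply directly.\<close>

definition sq_norm :: "('a::euclidean_space \<Rightarrow> complex) \<Rightarrow> ennreal" where
  "sq_norm f = (\<integral>\<^sup>+ x. ennreal ((cmod (f x))\<^sup>2) \<partial>lebesgue)"

lemma L2_norm_eq: "L2_norm f = (if sq_norm f = \<infinity> then \<infinity> else ennreal (sqrt (enn2real (sq_norm f))))"
  by (simp add: L2_norm_def sq_norm_def Let_def)

lemma L2_norm_square: "L2_norm f * L2_norm f = sq_norm f"
  by (auto simp: L2_norm_eq ennreal_mult[symmetric] less_top)

lemma L2_norm_finite_iff: "L2_norm f < \<infinity> \<longleftrightarrow> sq_norm f < \<infinity>"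
  by (auto simp: L2_norm_eq less_top)

lemma L2_iff: "f \<in> L2 \<longleftrightarrow> f \<in> borel_measurable lebesgue \<and> sq_norm f < \<infinity>"
  using L2_norm_finite_iff[of f] by (simp add: L2_def)

lemma L2_norm_leI:
  assumes "sq_norm f \<le> K * K"
  shows "L2_norm f \<le> K"
proof (cases K)
  case (real k)
  with assms have *: "sq_norm f \<le> ennreal (k * k)" by (simp add: ennreal_mult)
  then have "sq_norm f < \<infinity>" using order_le_less_trans by fastforce
  moreover have "enn2real (sq_norm f) \<le> k * k" using * real by (intro enn2real_leI) auto
  ultimately show ?thesis using real
    by (auto simp: L2_norm_eq intro!: ennreal_leI real_le_lsqrt simp: power2_eq_square)
qed simp

lemma L2_norm_geI:
  assumes "ennreal (k * k) \<le> sq_norm f" "k \<ge> 0"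
  shows "ennreal k \<le> L2_norm f"
proof (cases "sq_norm f")
  case (real r)
  then have "k * k \<le> r" using assms by (simp add: ennreal_le_iff)
  then show ?thesis using real assms
    by (auto simp: L2_norm_eq intro!: ennreal_leI real_le_rsqrt simp: power2_eq_square)
qed (simp add: L2_norm_eq)

lemma L2_norm_tendsto_0_iff: "((\<lambda>k. L2_norm (f k)) \<longlonglongrightarrow> 0) \<longleftrightarrow> ((\<lambda>k. sq_norm (f k)) \<longlonglongrightarrow> 0)"
proof
  assume "(\<lambda>k. L2_norm (f k)) \<longlonglongrightarrow> 0"
  then have "(\<lambda>k. L2_norm (f k) * L2_norm (f k)) \<longlonglongrightarrow> 0 * 0"
    by (intro tendsto_mult_ennreal) auto
  then show "(\<lambda>k. sq_norm (f k)) \<longlonglongrightarrow> 0" by (simp add: L2_norm_square)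
next
  assume *: "(\<lambda>k. sq_norm (f k)) \<longlonglongrightarrow> 0"
  then have "\<forall>\<^sub>F k in sequentially. sq_norm (f k) < \<infinity>" by (rule order_tendstoD) simp
  then have ev: "\<forall>\<^sub>F k in sequentially. ennreal (sqrt (enn2real (sq_norm (f k)))) = L2_norm (f k)"
    by eventually_elim (auto simp: L2_norm_eq)
  have "(\<lambda>k. enn2real (sq_norm (f k))) \<longlonglongrightarrow> 0" using * by (intro tendsto_enn2real) auto
  then have "(\<lambda>k. ennreal (sqrt (enn2real (sq_norm (f k))))) \<longlonglongrightarrow> ennreal (sqrt 0)"
    by (intro tendsto_ennrealI tendsto_real_sqrt)
  with ev show "(\<lambda>k. L2_norm (f k)) \<longlonglongrightarrow> 0" by (simp add: Lim_transform_eventually)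
qed

text \<open>The inequality (p + q)^2 \<le> 2 p^2 + 2 q^2 stands in for the triangle inequality in
  \<open>L2\<close>; the factors 2 only affect constants. The pointwise hypothesis lets it serve
  sums and differences alike.\<close>

lemma sq_norm_bound:
  fixes a b c :: "'a::euclidean_space \<Rightarrow> complex"
  assumes [measurable]: "a \<in> borel_measurable lebesgue" "b \<in> borel_measurable lebesgue"
    and le: "AE x in lebesgue. cmod (c x) \<le> cmod (a x) + cmod (b x)"
  shows "sq_norm c \<le> 2 * sq_norm a + 2 * sq_norm b"
proof -
  have "sq_norm c \<le> (\<integral>\<^sup>+x. 2 * ennreal ((cmod (a x))\<^sup>2) + 2 * ennreal ((cmod (b x))\<^sup>2) \<partial>lebesgue)"
    unfolding sq_norm_def using le
  proof (intro nn_integral_mono_AE, eventually_elim)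
    fix x assume "cmod (c x) \<le> cmod (a x) + cmod (b x)"
    then have "(cmod (c x))\<^sup>2 \<le> (cmod (a x) + cmod (b x))\<^sup>2" by (intro power_mono) auto
    also have "\<dots> \<le> 2 * (cmod (a x))\<^sup>2 + 2 * (cmod (b x))\<^sup>2"
      using sum_squares_bound[of "cmod (a x)" "cmod (b x)"] by (simp add: power2_sum)
    finally have "ennreal ((cmod (c x))\<^sup>2) \<le> ennreal (2 * (cmod (a x))\<^sup>2 + 2 * (cmod (b x))\<^sup>2)"
      by (rule ennreal_leI)
    then show "ennreal ((cmod (c x))\<^sup>2) \<le> 2 * ennreal ((cmod (a x))\<^sup>2) + 2 * ennreal ((cmod (b x))\<^sup>2)"
      by (simp add: ennreal_mult)
  qed
  also have "\<dots> = 2 * sq_norm a + 2 * sq_norm b"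
    unfolding sq_norm_def by (subst nn_integral_add) (auto simp: nn_integral_cmult)
  finally show ?thesis .
qed

lemma sq_norm_diff_le:
  fixes a b c :: "'a::euclidean_space \<Rightarrow> complex"
  assumes [measurable]: "a \<in> borel_measurable lebesgue" "b \<in> borel_measurable lebesgue" "c \<in> borel_measurable lebesgue"
  shows "sq_norm (\<lambda>x. a x - c x) \<le> 2 * sq_norm (\<lambda>x. a x - b x) + 2 * sq_norm (\<lambda>x. b x - c x)"
  by (rule sq_norm_bound) (auto intro!: AE_I2 order_trans[OF _ norm_triangle_ineq])

lemma sq_norm_minus_commute: "sq_norm (\<lambda>x. a x - b x) = sq_norm (\<lambda>x. b x - a x)"
  by (simp add: sq_norm_def norm_minus_commute)

lemma integrable_cis_mult:
  assumes "integrable M f" "h \<in> borel_measurable M"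
  shows "integrable M (\<lambda>x. cis (h x) * f x)"
proof (rule Bochner_Integration.integrable_bound[OF assms(1)])
  show "(\<lambda>x. cis (h x) * f x) \<in> borel_measurable M"
    using assms(2) borel_measurable_integrable[OF assms(1)] by measurable
qed (simp add: norm_mult)

lemma fourier_L1_diff:
  assumes "f \<in> L1" "g \<in> L1"
  shows "fourier_L1 (\<lambda>x. f x - g x) \<xi> = fourier_L1 f \<xi> - fourier_L1 g \<xi>"
  using assms unfolding L1_iff_integrable fourier_L1_def right_diff_distrib
  by (intro Bochner_Integration.integral_diff integrable_cis_mult) auto

lemma sq_norm_fourier_diff_le:
  fixes f g :: "'a::euclidean_space \<Rightarrow> complex"
  assumes "f \<in> L1" "g \<in> L1"
  shows "sq_norm (\<lambda>\<xi>. fourier_L1 f \<xi> - fourier_L1 g \<xi>) \<le> ennreal ((2 * pi) ^ DIM('a)) * sq_norm (\<lambda>x. f x - g x)"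
  using bessel[of "\<lambda>x. f x - g x"] assms
  by (simp add: fourier_L1_diff sq_norm_def L1_iff_integrable)

lemma ennreal_not_infE:
  assumes "(x::ennreal) \<noteq> \<infinity>"
  obtains K where "x = ennreal K" "K \<ge> 0"
  using assms by (cases x) auto

text \<open>Each term is at most the finite sum \<open>K\<close>, so the k-th increment is at most
  \<open>sqrt K / 2 ^ k\<close>. The weights are what lets a sum of squares control a sum of
  moduli.\<close>

lemma convergent_if_weighted_increments:
  fixes a :: "nat \<Rightarrow> complex"
  assumes "(\<Sum>k. ennreal ((2 ^ k * cmod (a k - a (Suc k)))\<^sup>2)) \<noteq> \<infinity>"
  shows "convergent a"
proof -
  define e where "e = (\<lambda>k. (2 ^ k * cmod (a k - a (Suc k)))\<^sup>2)"
  obtain K where K: "(\<Sum>k. ennreal (e k)) = ennreal K" "K \<ge> 0"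
    by (rule ennreal_not_infE[OF assms]) (simp add: e_def)
  have "norm (a (Suc k) - a k) \<le> sqrt K * (1/2) ^ k" for k
  proof -
    have "ennreal (e k) \<le> ennreal K"
      unfolding K(1)[symmetric] using sum_le_suminf[of "\<lambda>k. ennreal (e k)" "{k}"] by simp
    then have "(2 ^ k * cmod (a k - a (Suc k)))\<^sup>2 \<le> K" using K(2) by (simp add: ennreal_le_iff e_def)
    then have "2 ^ k * cmod (a k - a (Suc k)) \<le> sqrt K" by (rule real_le_rsqrt)
    then show ?thesis by (simp add: field_simps norm_minus_commute)
  qed
  moreover have "summable (\<lambda>k. sqrt K * (1/2) ^ k)"
    by (intro summable_mult summable_geometric) simp
  ultimately have "summable (\<lambda>k. a (Suc k) - a k)"
    by (rule summable_comparison_test'[where N=0, rotated])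
  then have "convergent (\<lambda>n. \<Sum>k<n. a (Suc k) - a k)" by (simp only: summable_iff_convergent)
  then have "convergent (\<lambda>n. a n - a 0)" by (simp only: sum_lessThan_telescope)
  from convergent_add[OF this convergent_const[of "a 0"]] show ?thesis by simp
qed

text \<open>A Riesz-Fischer argument: truncations to balls approximate \<open>f\<close>,
  \<open>bessel\<close> makes their transforms a Cauchy sequence, and along a fast subsequence the
  increments are summable almost everywhere. The pointwise limit is then the limit in mean square as
  well.\<close>

lemma exists_has_fourier_L2:
  fixes f :: "'a::euclidean_space \<Rightarrow> complex"
  assumes "f \<in> L2"
  shows "\<exists>F. has_fourier_L2 f F"
proof -
  have [measurable]: "f \<in> borel_measurable lebesgue" and fin: "sq_norm f < \<infinity>"
    using assms by (auto simp: L2_iff)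
  define \<psi> where "\<psi> = (\<lambda>(k::nat) x. indicator (ball 0 (real k)) x * f x)"
  define c where "c = (2 * pi) ^ DIM('a)"
  have c: "c > 0" by (simp add: c_def)
  have [measurable]: "ball 0 (real k) \<in> sets (lebesgue :: 'a measure)" for k
    by (intro sets_completionI_sets) auto
  have \<psi>_meas [measurable]: "\<psi> k \<in> borel_measurable lebesgue" for k unfolding \<psi>_def by measurable
  have \<psi>_L1: "\<psi> k \<in> L1" for k
  proof -
    \<comment> \<open>On a ball of finite measure this turns square integrability into
      integrability.\<close>
    have "cmod z \<le> 1 + (cmod z)\<^sup>2" for z
      using zero_le_power2[of "cmod z - 1/2"] by (simp add: power2_eq_square algebra_simps)
    then have "L1_norm (\<psi> k) \<le> (\<integral>\<^sup>+x. indicator (ball 0 (real k)) x + ennreal ((cmod (f x))\<^sup>2) \<partial>lebesgue)"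
      unfolding L1_norm_def
      by (intro nn_integral_mono) (auto simp: \<psi>_def indicator_def norm_mult ennreal_plus[symmetric] ennreal_1[symmetric]
           simp del: ennreal_plus ennreal_1 intro!: ennreal_leI)
    also have "\<dots> = emeasure lebesgue (ball (0::'a) (real k)) + sq_norm f"
      by (subst nn_integral_add) (auto simp: sq_norm_def)
    also have "\<dots> < \<infinity>" using fin emeasure_lborel_ball_finite[of "0::'a" "real k"] by simp
    finally show ?thesis by (simp add: L1_def)
  qed
  have \<psi>_L2: "\<psi> k \<in> L2" for k
  proof -
    have "sq_norm (\<psi> k) \<le> sq_norm f"
      unfolding sq_norm_def by (intro nn_integral_mono) (auto simp: \<psi>_def indicator_def)
    then show ?thesis using fin by (auto simp: L2_iff intro: order_le_less_trans)
  qed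
  have "(\<lambda>k. sq_norm (\<lambda>x. \<psi> k x - f x)) \<longlonglongrightarrow> (\<integral>\<^sup>+x. 0 \<partial>(lebesgue :: 'a measure))"
    unfolding sq_norm_def
  proof (rule nn_integral_dominated_convergence[where w="\<lambda>x. ennreal ((cmod (f x))\<^sup>2)"])
    show "(\<integral>\<^sup>+x. ennreal ((cmod (f x))\<^sup>2) \<partial>lebesgue) < \<infinity>" using fin by (simp add: sq_norm_def)
    show "AE x in lebesgue. (\<lambda>k. ennreal ((cmod (\<psi> k x - f x))\<^sup>2)) \<longlonglongrightarrow> 0"
    proof (rule AE_I2)
      fix x :: 'a
      obtain N where N: "norm x < real N" using reals_Archimedean2 by blast
      have "\<forall>\<^sub>F k in sequentially. 0 = ennreal ((cmod (\<psi> k x - f x))\<^sup>2)"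
        using eventually_ge_at_top[of N] by eventually_elim (use N in \<open>auto simp: \<psi>_def indicator_def\<close>)
      then show "(\<lambda>k. ennreal ((cmod (\<psi> k x - f x))\<^sup>2)) \<longlonglongrightarrow> 0"
        by (rule Lim_transform_eventually[OF tendsto_const])
    qed
  qed (auto simp: \<psi>_def indicator_def)
  then have lim: "(\<lambda>k. sq_norm (\<lambda>x. \<psi> k x - f x)) \<longlonglongrightarrow> 0" by simp
  \<comment> \<open>The rate 8^-k has to beat the weight (2^k)^2 = 4^k of the increments; the ratio
    2^-k is summable.\<close>
  have "\<exists>r. sq_norm (\<lambda>x. \<psi> r x - f x) \<le> ennreal ((1/8) ^ k)" for k
  proof -
    have "\<forall>\<^sub>F r in sequentially. sq_norm (\<lambda>x. \<psi> r x - f x) < ennreal ((1/8) ^ k)"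
      by (rule order_tendstoD(2)[OF lim]) (simp add: ennreal_zero_less_one)
    then show ?thesis by (auto simp: eventually_sequentially intro: less_imp_le)
  qed
  then obtain r where r: "\<And>k. sq_norm (\<lambda>x. \<psi> (r k) x - f x) \<le> ennreal ((1/8) ^ k)" by metis
  define \<phi> where "\<phi> = (\<lambda>k. \<psi> (r k))"
  have \<phi>_L1: "\<phi> k \<in> L1" and \<phi>_L2: "\<phi> k \<in> L2" for k by (simp_all add: \<phi>_def \<psi>_L1 \<psi>_L2)
  have [measurable]: "\<phi> k \<in> borel_measurable lebesgue" for k by (simp add: \<phi>_def)
  have hat_meas [measurable]: "fourier_L1 (\<phi> k) \<in> borel_measurable lebesgue" for k
    by (rule fourier_L1_measurable[OF \<phi>_L1])
  have \<phi>_lim: "(\<lambda>k. sq_norm (\<lambda>x. \<phi> k x - f x)) \<longlonglongrightarrow> 0"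
  proof (rule tendsto_sandwich[of "\<lambda>_. 0" _ _ "\<lambda>k. ennreal ((1/8) ^ k)"])
    have "(\<lambda>k. ennreal ((1/8) ^ k)) \<longlonglongrightarrow> ennreal 0"
      by (intro tendsto_ennrealI LIMSEQ_realpow_zero) auto
    then show "(\<lambda>k. ennreal ((1/8) ^ k)) \<longlonglongrightarrow> 0" by simp
  qed (auto simp: \<phi>_def r)
  have cauchy: "sq_norm (\<lambda>\<xi>. fourier_L1 (\<phi> k) \<xi> - fourier_L1 (\<phi> j) \<xi>) \<le> ennreal (4 * c * (1/8) ^ k)"
    if "k \<le> j" for k j
  proof -
    have "sq_norm (\<lambda>x. \<phi> k x - \<phi> j x) \<le> 2 * sq_norm (\<lambda>x. \<phi> k x - f x) + 2 * sq_norm (\<lambda>x. f x - \<phi> j x)"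
      by (rule sq_norm_diff_le) auto
    also have "\<dots> \<le> 2 * ennreal ((1/8) ^ k) + 2 * ennreal ((1/8) ^ j)"
      using r[of k] r[of j] by (intro add_mono mult_left_mono) (auto simp: \<phi>_def sq_norm_minus_commute[of f])
    also have "\<dots> \<le> 2 * ennreal ((1/8) ^ k) + 2 * ennreal ((1/8) ^ k)"
      using that by (intro add_mono mult_left_mono ennreal_leI power_decreasing) auto
    also have "\<dots> = ennreal (4 * (1/8) ^ k)"
      by (simp add: ennreal_mult flip: distrib_right)
    finally have "sq_norm (\<lambda>x. \<phi> k x - \<phi> j x) \<le> ennreal (4 * (1/8) ^ k)" .
    then have "ennreal c * sq_norm (\<lambda>x. \<phi> k x - \<phi> j x) \<le> ennreal c * ennreal (4 * (1/8) ^ k)"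
      by (rule mult_left_mono) simp
    also have "\<dots> = ennreal (4 * c * (1/8) ^ k)" using c by (simp add: ennreal_mult[symmetric] ac_simps)
    finally show ?thesis
      using sq_norm_fourier_diff_le[OF \<phi>_L1[of k] \<phi>_L1[of j]] by (auto simp: c_def)
  qed
  define d where "d = (\<lambda>k \<xi>. fourier_L1 (\<phi> k) \<xi> - fourier_L1 (\<phi> (Suc k)) \<xi>)"
  have "(\<integral>\<^sup>+\<xi>. (\<Sum>k. ennreal ((2 ^ k * cmod (d k \<xi>))\<^sup>2)) \<partial>lebesgue)
      = (\<Sum>k. \<integral>\<^sup>+\<xi>. ennreal ((2 ^ k * cmod (d k \<xi>))\<^sup>2) \<partial>lebesgue)"
    by (rule nn_integral_suminf) (simp add: d_def)
  also have "\<dots> \<le> (\<Sum>k. ennreal (4 * c * (1/2) ^ k))"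
  proof (rule suminf_le)
    fix k
    have "(2 ^ k)\<^sup>2 = (4::real) ^ k" by (simp add: power2_eq_square flip: power_mult_distrib)
    then have "(\<integral>\<^sup>+\<xi>. ennreal ((2 ^ k * cmod (d k \<xi>))\<^sup>2) \<partial>lebesgue) = ennreal (4 ^ k) * sq_norm (d k)"
      unfolding sq_norm_def
      by (subst nn_integral_cmult[symmetric])
         (auto simp: d_def power_mult_distrib ennreal_mult)
    also have "\<dots> \<le> ennreal (4 ^ k) * ennreal (4 * c * (1/8) ^ k)"
      unfolding d_def by (intro mult_left_mono cauchy) auto
    also have "\<dots> = ennreal (4 * c * (4 ^ k * (1/8) ^ k))" using c by (simp add: ennreal_mult[symmetric] ac_simps)
    also have "4 ^ k * (1/8) ^ k = (1/2 :: real) ^ k" by (simp flip: power_mult_distrib)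
    finally show "(\<integral>\<^sup>+\<xi>. ennreal ((2 ^ k * cmod (d k \<xi>))\<^sup>2) \<partial>lebesgue) \<le> ennreal (4 * c * (1/2) ^ k)" .
  qed auto
  also have "\<dots> = ennreal (\<Sum>k. 4 * c * (1/2) ^ k)"
  proof (rule suminf_ennreal2)
    show "summable (\<lambda>k. 4 * c * (1/2) ^ k)" by (intro summable_mult summable_geometric) simp
  qed (use c in simp)
  also have "\<dots> < \<infinity>" by simp
  finally have "AE \<xi> in lebesgue. (\<Sum>k. ennreal ((2 ^ k * cmod (d k \<xi>))\<^sup>2)) \<noteq> \<infinity>"
    by (intro nn_integral_PInf_AE) (auto simp: d_def)
  then have conv: "AE \<xi> in lebesgue. convergent (\<lambda>k. fourier_L1 (\<phi> k) \<xi>)"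
    unfolding d_def by (rule AE_mp) (intro AE_I2 impI convergent_if_weighted_increments)
  \<comment> \<open>Where the sequence diverges the value is unspecified, but this happens only on a
    null set.\<close>
  define F where "F = (\<lambda>\<xi>. lim (\<lambda>k. fourier_L1 (\<phi> k) \<xi>))"
  have F_meas [measurable]: "F \<in> borel_measurable lebesgue" unfolding F_def by measurable
  \<comment> \<open>Fatou's lemma in \<open>j\<close> carries the bound \<open>cauchy\<close> over
    to the limit.\<close>
  have close: "sq_norm (\<lambda>\<xi>. fourier_L1 (\<phi> k) \<xi> - F \<xi>) \<le> ennreal (4 * c * (1/8) ^ k)" for k
  proof -
    have "AE \<xi> in lebesgue. ennreal ((cmod (fourier_L1 (\<phi> k) \<xi> - F \<xi>))\<^sup>2)
        = liminf (\<lambda>j. ennreal ((cmod (fourier_L1 (\<phi> k) \<xi> - fourier_L1 (\<phi> j) \<xi>))\<^sup>2))"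
      using conv
    proof eventually_elim
      fix \<xi> assume "convergent (\<lambda>k. fourier_L1 (\<phi> k) \<xi>)"
      then have "(\<lambda>j. fourier_L1 (\<phi> j) \<xi>) \<longlonglongrightarrow> F \<xi>" by (simp add: F_def convergent_LIMSEQ_iff)
      then have "(\<lambda>j. ennreal ((cmod (fourier_L1 (\<phi> k) \<xi> - fourier_L1 (\<phi> j) \<xi>))\<^sup>2))
         \<longlonglongrightarrow> ennreal ((cmod (fourier_L1 (\<phi> k) \<xi> - F \<xi>))\<^sup>2)"
        by (intro tendsto_ennrealI tendsto_intros)
      from lim_imp_Liminf[OF _ this] show "ennreal ((cmod (fourier_L1 (\<phi> k) \<xi> - F \<xi>))\<^sup>2)
        = liminf (\<lambda>j. ennreal ((cmod (fourier_L1 (\<phi> k) \<xi> - fourier_L1 (\<phi> j) \<xi>))\<^sup>2))" by simp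
    qed
    then have "sq_norm (\<lambda>\<xi>. fourier_L1 (\<phi> k) \<xi> - F \<xi>)
       = (\<integral>\<^sup>+\<xi>. liminf (\<lambda>j. ennreal ((cmod (fourier_L1 (\<phi> k) \<xi> - fourier_L1 (\<phi> j) \<xi>))\<^sup>2)) \<partial>lebesgue)"
      unfolding sq_norm_def by (rule nn_integral_cong_AE)
    also have "\<dots> \<le> liminf (\<lambda>j. sq_norm (\<lambda>\<xi>. fourier_L1 (\<phi> k) \<xi> - fourier_L1 (\<phi> j) \<xi>))"
      unfolding sq_norm_def by (rule nn_integral_liminf) simp
    also have "\<dots> \<le> ennreal (4 * c * (1/8) ^ k)"
      by (intro Liminf_le eventually_mono[OF eventually_ge_at_top[of k]] cauchy) auto
    finally show ?thesis .
  qed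
  have F_lim: "(\<lambda>k. sq_norm (\<lambda>\<xi>. fourier_L1 (\<phi> k) \<xi> - F \<xi>)) \<longlonglongrightarrow> 0"
  proof (rule tendsto_sandwich[of "\<lambda>_. 0" _ _ "\<lambda>k. ennreal (4 * c * (1/8) ^ k)"])
    have "(\<lambda>k. ennreal (4 * c * (1/8) ^ k)) \<longlonglongrightarrow> ennreal (4 * c * 0)"
      by (intro tendsto_ennrealI tendsto_mult_left LIMSEQ_realpow_zero) auto
    then show "(\<lambda>k. ennreal (4 * c * (1/8) ^ k)) \<longlonglongrightarrow> 0" by simp
  qed (auto simp: close)
  have "sq_norm F \<le> 2 * sq_norm (\<lambda>\<xi>. fourier_L1 (\<phi> 0) \<xi> - F \<xi>) + 2 * sq_norm (fourier_L1 (\<phi> 0))"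
    by (intro sq_norm_bound AE_I2) (use norm_triangle_sub in \<open>auto simp: norm_minus_commute add.commute\<close>)
  also have "\<dots> < \<infinity>"
  proof -
    have "sq_norm (fourier_L1 (\<phi> 0)) < \<infinity>"
      using bessel[OF \<phi>_L1[of 0], folded sq_norm_def] \<phi>_L2[of 0] unfolding L2_iff
      by (elim order_le_less_trans) (simp add: ennreal_mult_less_top)
    moreover have "sq_norm (\<lambda>\<xi>. fourier_L1 (\<phi> 0) \<xi> - F \<xi>) < \<infinity>"
      by (rule order_le_less_trans[OF close[of 0]]) simp
    ultimately show ?thesis by (simp add: ennreal_mult_less_top)
  qed
  finally have "F \<in> L2" by (simp add: L2_iff)
  then show ?thesis unfolding has_fourier_L2_def L2_norm_tendsto_0_iff
    using \<phi>_L1 \<phi>_L2 \<phi>_lim F_lim by blast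
qed

lemma has_fourier_L2_fourier_L2: "f \<in> L2 \<Longrightarrow> has_fourier_L2 f (fourier_L2 f)"
  unfolding fourier_L2_def by (rule someI_ex[OF exists_has_fourier_L2])

text \<open>The factor 4 beyond \<open>bessel\<close> comes from two uses of
  \<open>sq_norm_bound\<close>, one on each side of the transform; the error terms vanish along the
  approximating sequence.\<close>

lemma sq_norm_fourier_L2_le:
  fixes f :: "'a::euclidean_space \<Rightarrow> complex"
  assumes "f \<in> L2"
  shows "sq_norm (fourier_L2 f) \<le> ennreal (4 * (2 * pi) ^ DIM('a)) * sq_norm f"
proof -
  let ?F = "fourier_L2 f" and ?c = "ennreal ((2 * pi) ^ DIM('a))"
  obtain \<phi> where F: "?F \<in> L2" and \<phi>: "\<And>k::nat. \<phi> k \<in> L1" "\<And>k. \<phi> k \<in> L2"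
    and lims: "(\<lambda>k. sq_norm (\<lambda>x. \<phi> k x - f x)) \<longlonglongrightarrow> 0"
      "(\<lambda>k. sq_norm (\<lambda>\<xi>. fourier_L1 (\<phi> k) \<xi> - ?F \<xi>)) \<longlonglongrightarrow> 0"
    using has_fourier_L2_fourier_L2[OF assms] unfolding has_fourier_L2_def L2_norm_tendsto_0_iff by blast
  have [measurable]: "?F \<in> borel_measurable lebesgue" "f \<in> borel_measurable lebesgue"
    "\<And>k. \<phi> k \<in> borel_measurable lebesgue"
    using F assms \<phi> by (auto simp: L2_iff)
  have [measurable]: "fourier_L1 (\<phi> k) \<in> borel_measurable lebesgue" for k
    by (rule fourier_L1_measurable[OF \<phi>(1)])
  have bd: "sq_norm ?F \<le> 2 * sq_norm (\<lambda>\<xi>. fourier_L1 (\<phi> k) \<xi> - ?F \<xi>) +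
     2 * (?c * (2 * sq_norm (\<lambda>x. \<phi> k x - f x) + 2 * sq_norm f))" for k
  proof -
    have "sq_norm ?F \<le> 2 * sq_norm (\<lambda>\<xi>. fourier_L1 (\<phi> k) \<xi> - ?F \<xi>) + 2 * sq_norm (fourier_L1 (\<phi> k))"
      by (intro sq_norm_bound AE_I2) (use norm_triangle_sub in \<open>auto simp: norm_minus_commute add.commute\<close>)
    also have "sq_norm (fourier_L1 (\<phi> k)) \<le> ?c * sq_norm (\<phi> k)"
      using bessel[OF \<phi>(1)[of k]] by (simp add: sq_norm_def)
    also have "sq_norm (\<phi> k) \<le> 2 * sq_norm (\<lambda>x. \<phi> k x - f x) + 2 * sq_norm f"
      by (intro sq_norm_bound AE_I2) (use norm_triangle_sub in \<open>auto simp: add.commute\<close>)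
    finally show ?thesis by (simp add: mult_left_mono add_left_mono)
  qed
  have "(\<lambda>k. 2 * sq_norm (\<lambda>\<xi>. fourier_L1 (\<phi> k) \<xi> - ?F \<xi>) +
     2 * (?c * (2 * sq_norm (\<lambda>x. \<phi> k x - f x) + 2 * sq_norm f))) \<longlonglongrightarrow> 2 * 0 + 2 * (?c * (2 * 0 + 2 * sq_norm f))"
    by (intro tendsto_add tendsto_mult_ennreal tendsto_const lims) auto
  from LIMSEQ_le_const[OF this] bd
  have "sq_norm ?F \<le> 2 * 0 + 2 * (?c * (2 * 0 + 2 * sq_norm f))" by blast
  also have "\<dots> = ennreal (4 * (2 * pi) ^ DIM('a)) * sq_norm f"
  proof -
    have "2 * (?c * (2 * sq_norm f)) = (2 * 2) * ?c * sq_norm f" by (simp only: ac_simps)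
    then show ?thesis by (simp add: ennreal_mult)
  qed
  finally show ?thesis .
qed

text \<open>Whatever representative was chosen, both sides are mean square limits of the transforms
  of one approximating sequence. In \<open>wave_lower\<close> this gives the transform of
  \<open>w0\<close> a pointwise bound.\<close>

lemma fourier_L2_eq_fourier_L1:
  fixes f :: "'a::euclidean_space \<Rightarrow> complex"
  assumes "f \<in> L1" "f \<in> L2"
  shows "AE \<xi> in lebesgue. fourier_L2 f \<xi> = fourier_L1 f \<xi>"
proof -
  let ?F = "fourier_L2 f" and ?c = "ennreal ((2 * pi) ^ DIM('a))"
  obtain \<phi> where F: "?F \<in> L2" and \<phi>: "\<And>k::nat. \<phi> k \<in> L1"
    and lims: "(\<lambda>k. sq_norm (\<lambda>x. \<phi> k x - f x)) \<longlonglongrightarrow> 0"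
      "(\<lambda>k. sq_norm (\<lambda>\<xi>. fourier_L1 (\<phi> k) \<xi> - ?F \<xi>)) \<longlonglongrightarrow> 0"
    using has_fourier_L2_fourier_L2[OF assms(2)] unfolding has_fourier_L2_def L2_norm_tendsto_0_iff by blast
  have [measurable]: "?F \<in> borel_measurable lebesgue" using F by (auto simp: L2_iff)
  have [measurable]: "fourier_L1 (\<phi> k) \<in> borel_measurable lebesgue" "fourier_L1 f \<in> borel_measurable lebesgue" for k
    by (rule fourier_L1_measurable[OF \<phi>(1)], rule fourier_L1_measurable[OF assms(1)])
  have bd: "sq_norm (\<lambda>\<xi>. ?F \<xi> - fourier_L1 f \<xi>) \<le> 2 * sq_norm (\<lambda>\<xi>. fourier_L1 (\<phi> k) \<xi> - ?F \<xi>) +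
     2 * (?c * sq_norm (\<lambda>x. \<phi> k x - f x))" for k
  proof -
    have "sq_norm (\<lambda>\<xi>. ?F \<xi> - fourier_L1 f \<xi>) \<le> 2 * sq_norm (\<lambda>\<xi>. ?F \<xi> - fourier_L1 (\<phi> k) \<xi>)
        + 2 * sq_norm (\<lambda>\<xi>. fourier_L1 (\<phi> k) \<xi> - fourier_L1 f \<xi>)"
      by (rule sq_norm_diff_le) auto
    then show ?thesis
      using sq_norm_fourier_diff_le[OF \<phi>(1)[of k] assms(1)]
      by (simp add: sq_norm_minus_commute[of ?F]) (meson add_left_mono mult_left_mono order_trans zero_le)
  qed
  have "(\<lambda>k. 2 * sq_norm (\<lambda>\<xi>. fourier_L1 (\<phi> k) \<xi> - ?F \<xi>) +
     2 * (?c * sq_norm (\<lambda>x. \<phi> k x - f x))) \<longlonglongrightarrow> 2 * 0 + 2 * (?c * 0)"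
    by (intro tendsto_add tendsto_mult_ennreal tendsto_const lims) auto
  from LIMSEQ_le_const[OF this] bd
  have "sq_norm (\<lambda>\<xi>. ?F \<xi> - fourier_L1 f \<xi>) \<le> 2 * 0 + 2 * (?c * 0)" by blast
  then have "sq_norm (\<lambda>\<xi>. ?F \<xi> - fourier_L1 f \<xi>) = 0" by simp
  then show ?thesis unfolding sq_norm_def by (subst (asm) nn_integral_0_iff_AE) auto
qed

subsection \<open>Radial integrals\<close>

text \<open>Surface measure of the unit sphere, obtained as the derivative of the ball volume at
  radius 1.\<close>

definition sphere_area :: "'a::euclidean_space itself \<Rightarrow> real" where
  "sphere_area _ = real DIM('a) * unit_ball_vol (real DIM('a))"

lemma sphere_area_pos: "sphere_area TYPE('a::euclidean_space) > 0"
  by (simp add: sphere_area_def)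

text \<open>Polar coordinates for radial integrands, without a measure on the sphere: the half-lines
  \<open>{..a}\<close> generate the Borel sets, and on them both measures give the volume of the
  ball of radius \<open>a\<close>.\<close>

lemma distr_norm_lborel:
  "distr lborel borel (norm :: 'a::euclidean_space \<Rightarrow> real) =
   density lborel (\<lambda>r. ennreal (sphere_area TYPE('a) * r ^ (DIM('a) - 1)) * indicator {0..} r)" (is "?M = ?N")
proof (rule measure_eqI_generator_eq_countable)
  let ?E = "range (\<lambda>a::real. {..a})"
  show "Int_stable ?E" by (auto simp: Int_stable_def)
  show "?E \<subseteq> Pow UNIV" "sets ?M = sigma_sets UNIV ?E" "sets ?N = sigma_sets UNIV ?E"
    by (auto simp: borel_eq_atMost sets_measure_of)
  have M: "emeasure ?M {..a} = ennreal (if a < 0 then 0 else unit_ball_vol (real DIM('a)) * a ^ DIM('a))" for a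
  proof -
    have "norm -` {..a} = cball (0::'a) a" by auto
    then show ?thesis by (simp add: emeasure_distr emeasure_cball)
  qed
  show "range (\<lambda>n::nat. {..real n}) \<subseteq> ?E" "\<Union>(range (\<lambda>n::nat. {..real n})) = UNIV"
    by (auto intro: real_arch_simple)
  show "emeasure ?M A \<noteq> \<infinity>" if "A \<in> range (\<lambda>n::nat. {..real n})" for A
    using that by (auto simp: M)
  fix X assume "X \<in> ?E"
  then obtain a where X: "X = {..a}" by auto
  have "emeasure ?N {..a} = (\<integral>\<^sup>+r. ennreal (sphere_area TYPE('a) * r ^ (DIM('a) - 1)) * indicator {0..a} r \<partial>lborel)"
    by (subst emeasure_density) (auto intro!: nn_integral_cong simp: indicator_def)
  also have "\<dots> = emeasure ?M {..a}"
  proof (cases "a < 0")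
    case False
    have "(\<integral>\<^sup>+r. ennreal (sphere_area TYPE('a) * r ^ (DIM('a) - 1)) * indicator {0..a} r \<partial>lborel)
       = ennreal (unit_ball_vol (real DIM('a)) * a ^ DIM('a) - unit_ball_vol (real DIM('a)) * 0 ^ DIM('a))"
      using False less_imp_le[OF sphere_area_pos[where 'a='a]]
      by (intro nn_integral_FTC_Icc) (auto intro!: derivative_eq_intros simp: sphere_area_def)
    then show ?thesis using False by (simp add: M)
  qed (simp add: M)
  finally show "emeasure ?M X = emeasure ?N X" by (simp add: X)
qed auto

lemma nn_integral_radial:
  fixes h :: "real \<Rightarrow> real"
  assumes [measurable]: "h \<in> borel_measurable borel" and "0 \<le> a"
  shows "(\<integral>\<^sup>+x. ennreal (h (norm (x :: 'a::euclidean_space))) * indicator {a..b} (norm x) \<partial>lebesgue)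
    = (\<integral>\<^sup>+r. ennreal (sphere_area TYPE('a) * (r ^ (DIM('a) - 1) * h r)) * indicator {a..b} r \<partial>lborel)"
proof -
  have "(\<integral>\<^sup>+x. ennreal (h (norm (x :: 'a))) * indicator {a..b} (norm x) \<partial>lebesgue)
    = (\<integral>\<^sup>+r. ennreal (h r) * indicator {a..b} r \<partial>distr lborel borel (norm :: 'a \<Rightarrow> real))"
    by (subst nn_integral_distr) (auto simp: nn_integral_completion)
  also have "\<dots> = (\<integral>\<^sup>+r. ennreal (sphere_area TYPE('a) * (r ^ (DIM('a) - 1) * h r)) * indicator {a..b} r \<partial>lborel)"
    unfolding distr_norm_lborel using assms(2) less_imp_le[OF sphere_area_pos[where 'a='a]]
    by (subst nn_integral_density)
       (auto intro!: nn_integral_cong simp: indicator_def ennreal_mult''[symmetric] ac_simps)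
  finally show ?thesis .
qed

lemma power_eq_powr: "r > 0 \<Longrightarrow> r ^ (DIM('a::euclidean_space) - Suc 0) = r powr (real DIM('a) - 1)"
  by (simp add: powr_realpow[symmetric] of_nat_diff Suc_leI)

lemma nn_integral_radial_powr_0:
  fixes p R :: real
  assumes "p < real DIM('a::euclidean_space)" "R \<ge> 0"
  shows "(\<integral>\<^sup>+x. ennreal (norm (x :: 'a) powr (- p)) * indicator {0..R} (norm x) \<partial>lebesgue)
    = ennreal (sphere_area TYPE('a) * (R powr (real DIM('a) - p) / (real DIM('a) - p)))"
proof -
  let ?n = "real DIM('a)" and ?w = "sphere_area TYPE('a)"
  have w: "?w > 0" by (rule sphere_area_pos)
  have "(\<integral>\<^sup>+x. ennreal (norm (x :: 'a) powr (- p)) * indicator {0..R} (norm x) \<partial>lebesgue)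
    = (\<integral>\<^sup>+r. ennreal (?w * (r ^ (DIM('a) - 1) * r powr (- p))) * indicator {0..R} r \<partial>lborel)"
    by (rule nn_integral_radial) auto
  also have "\<dots> = (\<integral>\<^sup>+r. ennreal ?w * ennreal (indicator {0..R} r * r powr (?n - p - 1)) \<partial>lborel)"
  proof (intro nn_integral_cong)
    fix r :: real
    have "r ^ (DIM('a) - 1) * r powr (- p) = r powr (?n - p - 1)" if "r > 0"
      using that by (simp add: power_eq_powr powr_add[symmetric] algebra_simps)
    \<comment> \<open>At \<open>r = 0\<close> both integrands vanish, since \<open>powr\<close> with
      base 0 is 0.\<close>
    moreover have "r \<in> {0..R} \<Longrightarrow> r > 0 \<or> r = 0" by auto
    ultimately show "ennreal (?w * (r ^ (DIM('a) - 1) * r powr (- p))) * indicator {0..R} r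
       = ennreal ?w * ennreal (indicator {0..R} r * r powr (?n - p - 1))"
      using w by (auto simp: indicator_def ennreal_mult[symmetric])
  qed
  also have "\<dots> = ennreal ?w * ennreal (R powr (?n - p - 1 + 1) / (?n - p - 1 + 1))"
  proof -
    have "((\<lambda>r. r powr (?n - p - 1)) has_integral R powr (?n - p - 1 + 1) / (?n - p - 1 + 1)) {0..R}"
      using assms by (intro has_integral_powr_from_0) auto
    from nn_integral_has_integral_lebesgue[OF _ this] show ?thesis
      by (subst nn_integral_cmult) auto
  qed
  also have "\<dots> = ennreal (?w * (R powr (?n - p - 1 + 1) / (?n - p - 1 + 1)))"
    using w by (intro ennreal_mult'[symmetric]) simp
  finally show ?thesis by simp
qed

lemma nn_integral_radial_powr:
  fixes p a b :: real
  assumes "0 < a" "a \<le> b"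
  shows "(\<integral>\<^sup>+x. ennreal (norm (x :: 'a::euclidean_space) powr (- p)) * indicator {a..b} (norm x) \<partial>lebesgue)
    = ennreal (sphere_area TYPE('a) * (if p = real DIM('a) then ln (b / a)
        else (b powr (real DIM('a) - p) - a powr (real DIM('a) - p)) / (real DIM('a) - p)))"
proof -
  let ?n = "real DIM('a)" and ?w = "sphere_area TYPE('a)"
  have w: "?w > 0" by (rule sphere_area_pos)
  define F where "F = (\<lambda>r. if p = ?n then ?w * ln r else ?w * (r powr (?n - p) / (?n - p)))"
  have D: "(F has_real_derivative ?w * r powr (?n - p - 1)) (at r)" if "r > 0" for r
    using that by (cases "p = ?n") (auto simp: F_def powr_minus divide_simps intro!: derivative_eq_intros)
  have "(\<integral>\<^sup>+x. ennreal (norm (x :: 'a) powr (- p)) * indicator {a..b} (norm x) \<partial>lebesgue)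
    = (\<integral>\<^sup>+r. ennreal (?w * (r ^ (DIM('a) - 1) * r powr (- p))) * indicator {a..b} r \<partial>lborel)"
    using assms by (intro nn_integral_radial) auto
  also have "\<dots> = (\<integral>\<^sup>+r. ennreal (?w * r powr (?n - p - 1)) * indicator {a..b} r \<partial>lborel)"
    using assms by (intro nn_integral_cong)
      (auto simp: indicator_def power_eq_powr powr_add[symmetric] algebra_simps)
  also have "\<dots> = ennreal (F b - F a)"
    using assms w by (intro nn_integral_FTC_Icc D) auto
  also have "F b - F a = ?w * (if p = ?n then ln (b / a) else (b powr (?n - p) - a powr (?n - p)) / (?n - p))"
    using assms by (auto simp: F_def ln_div right_diff_distrib diff_divide_distrib)
  finally show ?thesis .
qed

text \<open>For radii at most 1 the exponent may be lowered to the borderline value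
  \<open>DIM('a)\<close>, where the integral over a shell is a logarithm of the ratio of radii and
  exceeds every bound.\<close>

lemma nn_integral_radial_powr_infinite:
  fixes p \<delta> :: real
  assumes "real DIM('a::euclidean_space) \<le> p" "\<delta> > 0"
  shows "(\<integral>\<^sup>+x. ennreal (norm (x :: 'a) powr (- p)) * indicator {0<..\<delta>} (norm x) \<partial>lebesgue) = \<infinity>"
proof (rule ccontr)
  let ?n = "real DIM('a)" and ?w = "sphere_area TYPE('a)"
  let ?I = "\<integral>\<^sup>+x. ennreal (norm (x :: 'a) powr (- p)) * indicator {0<..\<delta>} (norm x) \<partial>lebesgue"
  assume "?I \<noteq> \<infinity>"
  then obtain K where K: "?I = ennreal K" "K \<ge> 0" by (cases ?I) auto
  have w: "?w > 0" by (rule sphere_area_pos)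
  define b where "b = min \<delta> 1"
  have b: "0 < b" "b \<le> \<delta>" "b \<le> 1" using assms by (auto simp: b_def)
  \<comment> \<open>Chosen so that the logarithmic integral over \<open>{a..b}\<close> is exactly
    \<open>K + 1\<close>.\<close>
  define a where "a = b * exp (- ((K + 1) / ?w))"
  have a: "0 < a" "a \<le> b" using b K w by (auto simp: a_def mult_le_cancel_left1)
  have "b / a = exp ((K + 1) / ?w)"
    using b by (simp add: a_def exp_minus field_simps)
  then have "ennreal (K + 1) = ennreal (?w * ln (b / a))"
    using w by simp
  also have "\<dots> = (\<integral>\<^sup>+x. ennreal (norm (x :: 'a) powr (- ?n)) * indicator {a..b} (norm x) \<partial>lebesgue)"
    using nn_integral_radial_powr[OF a, of ?n, where 'a='a] by simp
  also have "\<dots> \<le> ?I"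
  proof (intro nn_integral_mono)
    fix x :: 'a
    have "norm x powr - ?n \<le> norm x powr - p" if "norm x \<in> {a..b}"
      using that a b assms by (intro powr_mono') auto
    then show "ennreal (norm x powr - ?n) * indicator {a..b} (norm x)
       \<le> ennreal (norm x powr (- p)) * indicator {0<..\<delta>} (norm x)"
      using a b by (auto simp: indicator_def intro!: ennreal_leI)
  qed
  finally show False using K by (simp add: ennreal_le_iff)
qed

section \<open>Averaging the oscillation on the logarithmic scale\<close>

text \<open>
  If \<open>4A \<le> B\<close> and \<open>|sin u| B \<le> W + A\<close>, then \<open>B^2 osc \<le> W^2\<close>: a lower order term can be
  absorbed without losing the mean size of the oscillation.
\<close>

definition osc :: "real \<Rightarrow> real \<Rightarrow> real \<Rightarrow> real" where
  "osc \<sigma> t r = max 0 ((sin (r powr \<sigma> * t))\<^sup>2 / 2 - 1 / 16)"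

lemma osc_nonneg: "osc \<sigma> t r \<ge> 0"
  by (simp add: osc_def)

lemma osc_measurable [measurable]: "osc \<sigma> t \<in> borel_measurable borel"
  unfolding osc_def by measurable

text \<open>
  With \<open>u = r^\<sigma> t\<close>, the function \<open>3/16 ln r - sin (2u) / (8\<sigma>u)\<close> is an antiderivative of
  \<open>((sin u)^2 / 2 - 1/16) / r\<close> up to an error \<open>sin (2u) / (8ur)\<close>, which the derivative of
  \<open>1 / (8\<sigma>u)\<close> absorbs.
\<close>

lemma osc_integral_ge:
  fixes a b \<sigma> t :: real
  assumes a: "0 < a" "a \<le> b" and st: "\<sigma> > 0" "t > 0"
  shows "ennreal (3 / 16 * ln (b / a) - 1 / (4 * \<sigma> * (a powr \<sigma> * t)))
     \<le> (\<integral>\<^sup>+r. ennreal (osc \<sigma> t r / r) * indicator {a..b} r \<partial>lborel)"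
proof -
  define u where "u = (\<lambda>r. r powr \<sigma> * t)"
  \<comment> \<open>The slope 3/16 is the mean of \<open>(sin u)^2 / 2 - 1/16\<close>. Subtracting 1
    from the sine makes the error term in \<open>k\<close> nonpositive, so that \<open>k\<close>
    stays below the integrand.\<close>
  define K where "K = (\<lambda>r. 3 / 16 * ln r - (sin (2 * u r) - 1) / (8 * \<sigma> * u r))"
  define k where "k = (\<lambda>r. ((sin (u r))\<^sup>2 / 2 - 1 / 16) / r + (sin (2 * u r) - 1) / (8 * u r * r))"
  have u: "u r > 0" if "r > 0" for r using that st by (simp add: u_def)
  have Du: "(u has_real_derivative \<sigma> * u r / r) (at r)" if "r > 0" for r
    using that unfolding u_def by (auto intro!: derivative_eq_intros simp: powr_diff divide_simps)
  have DK: "(K has_real_derivative k r) (at r)" if r: "r > 0" for r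
  proof -
    have s: "(sin (u r))\<^sup>2 = (1 - cos (2 * u r)) / 2"
      by (simp add: cos_double_sin)
    have "(K has_real_derivative 3 / 16 * (1 / r) - ((cos (2 * u r) * (2 * (\<sigma> * u r / r))) * (8 * \<sigma> * u r)
        - (sin (2 * u r) - 1) * (8 * \<sigma> * (\<sigma> * u r / r))) / ((8 * \<sigma> * u r) * (8 * \<sigma> * u r))) (at r)"
      unfolding K_def using r u[OF r] st by (auto intro!: derivative_eq_intros Du[OF r])
    also have "3 / 16 * (1 / r) - ((cos (2 * u r) * (2 * (\<sigma> * u r / r))) * (8 * \<sigma> * u r)
        - (sin (2 * u r) - 1) * (8 * \<sigma> * (\<sigma> * u r / r))) / ((8 * \<sigma> * u r) * (8 * \<sigma> * u r)) = k r"
      unfolding k_def s using r u[OF r] st by (simp add: field_simps)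
    finally show ?thesis .
  qed
  have cont: "continuous_on {a..b} (\<lambda>r. osc \<sigma> t r / r)"
    unfolding osc_def using a by (intro continuous_intros) auto
  then have int: "((\<lambda>r. osc \<sigma> t r / r) has_integral integral {a..b} (\<lambda>r. osc \<sigma> t r / r)) {a..b}"
    by (intro integrable_integral integrable_continuous_real)
  have "(k has_integral K b - K a) {a..b}"
    using a by (intro fundamental_theorem_of_calculus)
      (auto simp: has_real_derivative_iff_has_vector_derivative[symmetric] intro: has_field_derivative_at_within[OF DK])
  then have le: "K b - K a \<le> integral {a..b} (\<lambda>r. osc \<sigma> t r / r)"
  proof (rule has_integral_le[OF _ int])
    fix r assume "r \<in> {a..b}"
    then have r: "r > 0" using a by auto
    have "(sin (2 * u r) - 1) / (8 * u r * r) \<le> 0"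
      using u[OF r] r by (intro divide_nonpos_nonneg) auto
    moreover have "((sin (u r))\<^sup>2 / 2 - 1 / 16) / r \<le> osc \<sigma> t r / r"
      using r by (intro divide_right_mono) (auto simp: osc_def u_def)
    ultimately show "k r \<le> osc \<sigma> t r / r" unfolding k_def by linarith
  qed
  have b: "b > 0" using a by simp
  \<comment> \<open>The boundary term at \<open>b\<close> has the favourable sign and is dropped;
    the one at \<open>a\<close> costs at most \<open>2 / (8 * \<sigma> * u a)\<close>, which is the
    loss in the statement.\<close>
  have "(sin (2 * u b) - 1) / (8 * \<sigma> * u b) \<le> 0"
    using u[OF b] st by (intro divide_nonpos_nonneg) auto
  moreover have "(sin (2 * u a) - 1) / (8 * \<sigma> * u a) \<ge> (- 2) / (8 * \<sigma> * u a)"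
    using u[OF a(1)] st sin_ge_minus_one[of "2 * u a"] by (intro divide_right_mono) (auto simp del: sin_ge_minus_one)
  moreover have "(- 2) / (8 * \<sigma> * u a) = - (1 / (4 * \<sigma> * u a))" by simp
  moreover have "ln (b / a) = ln b - ln a" using a b by (simp add: ln_div)
  ultimately have "3 / 16 * ln (b / a) - 1 / (4 * \<sigma> * u a) \<le> K b - K a"
    unfolding K_def by linarith
  with le have "3 / 16 * ln (b / a) - 1 / (4 * \<sigma> * u a) \<le> integral {a..b} (\<lambda>r. osc \<sigma> t r / r)" by linarith
  then have "ennreal (3 / 16 * ln (b / a) - 1 / (4 * \<sigma> * u a)) \<le> ennreal (integral {a..b} (\<lambda>r. osc \<sigma> t r / r))"
    by (rule ennreal_leI)
  also have "\<dots> = (\<integral>\<^sup>+r. ennreal (indicator {a..b} r * (osc \<sigma> t r / r)) \<partial>lborel)"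
    by (rule nn_integral_has_integral_lebesgue[symmetric, OF _ int]) (use a osc_nonneg in auto)
  also have "\<dots> = (\<integral>\<^sup>+r. ennreal (osc \<sigma> t r / r) * indicator {a..b} r \<partial>lborel)"
    by (intro nn_integral_cong) (auto simp: indicator_def)
  finally show ?thesis by (simp add: u_def)
qed

text \<open>The radial density is \<open>r powr (n - p)\<close> against \<open>dr / r\<close>;
  bounding the power below by \<open>c\<close> leaves the integral of
  \<open>osc_integral_ge\<close>. \<open>c\<close> and \<open>v\<close> stay free because each
  growth regime supplies its own values.\<close>

lemma osc_radial_integral_ge:
  fixes a b \<sigma> t p c :: real
  assumes a: "0 < a" "a \<le> b" and st: "\<sigma> > 0" "t > 0" and "c \<ge> 0"
    and c: "\<And>r. r \<in> {a..b} \<Longrightarrow> c \<le> r powr (real DIM('a::euclidean_space) - p)"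
    and v: "v \<le> 3 / 16 * ln (b / a) - 1 / (4 * \<sigma> * (a powr \<sigma> * t))"
  shows "ennreal (sphere_area TYPE('a) * c * v)
     \<le> (\<integral>\<^sup>+x. ennreal (norm (x :: 'a) powr (- p) * osc \<sigma> t (norm x)) * indicator {a..b} (norm x) \<partial>lebesgue)"
proof -
  let ?n = "real DIM('a)" and ?w = "sphere_area TYPE('a)"
  have w: "?w > 0" by (rule sphere_area_pos)
  have "ennreal (?w * c * v) = ennreal (?w * c) * ennreal v"
    using w \<open>c \<ge> 0\<close> by (intro ennreal_mult') simp
  also have "\<dots> \<le> ennreal (?w * c) * (\<integral>\<^sup>+r. ennreal (osc \<sigma> t r / r) * indicator {a..b} r \<partial>lborel)"
    by (intro mult_left_mono order_trans[OF ennreal_leI[OF v] osc_integral_ge[OF a st]]) auto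
  also have "\<dots> = (\<integral>\<^sup>+r. ennreal (?w * c) * (ennreal (osc \<sigma> t r / r) * indicator {a..b} r) \<partial>lborel)"
    by (rule nn_integral_cmult[symmetric]) simp
  also have "\<dots> \<le> (\<integral>\<^sup>+r. ennreal (?w * (r ^ (DIM('a) - 1) * (r powr (- p) * osc \<sigma> t r))) * indicator {a..b} r \<partial>lborel)"
  proof (intro nn_integral_mono)
    fix r :: real
    have "?w * c * (osc \<sigma> t r / r) \<le> ?w * (r ^ (DIM('a) - 1) * (r powr (- p) * osc \<sigma> t r))" if "r \<in> {a..b}"
    proof -
      have r: "r > 0" using that a by auto
      have "?w * c * (osc \<sigma> t r / r) \<le> ?w * (r powr (?n - p)) * (osc \<sigma> t r / r)"
        using w r osc_nonneg c[OF that] by (intro mult_right_mono mult_left_mono) auto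
      also have "\<dots> = ?w * (r powr (?n - p - 1) * osc \<sigma> t r)"
        using r by (simp add: powr_diff)
      also have "r powr (?n - p - 1) = r ^ (DIM('a) - 1) * r powr (- p)"
        using r by (simp add: power_eq_powr powr_add[symmetric] algebra_simps)
      finally show ?thesis by (simp add: mult.assoc)
    qed
    then show "ennreal (?w * c) * (ennreal (osc \<sigma> t r / r) * indicator {a..b} r)
      \<le> ennreal (?w * (r ^ (DIM('a) - 1) * (r powr (- p) * osc \<sigma> t r))) * indicator {a..b} r"
      using w \<open>c \<ge> 0\<close> by (auto simp: indicator_def ennreal_mult'[symmetric] intro!: ennreal_leI)
  qed
  also have "\<dots> = (\<integral>\<^sup>+x. ennreal (norm (x :: 'a) powr (- p) * osc \<sigma> t (norm x)) * indicator {a..b} (norm x) \<partial>lebesgue)"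
    using a by (intro nn_integral_radial[symmetric]) auto
  finally show ?thesis .
qed

subsection \<open>Low frequency estimates\<close>

text \<open>The exponent in the second bound is twice that of the subcritical rate. It is 0 at n =
  2\<sigma> + 2s and negative beyond, so a single power can be used in all regimes. The threshold
  \<open>exp 1\<close> ensures \<open>ln t \<ge> 1\<close>.\<close>

lemma growth_ge:
  fixes \<sigma> s t :: real and n :: nat
  assumes "\<sigma> \<ge> 1" "2 * s < real n" "t \<ge> exp 1"
  shows "1 \<le> growth n \<sigma> s t"
    and "t powr (2 - (real n - 2 * s) / \<sigma>) \<le> (growth n \<sigma> s t)\<^sup>2"
proof -
  have t: "t \<ge> 1" "t > 0" using assms(3) exp_ge_add_one_self[of 1] by linarith+
  have ln: "ln t \<ge> 1" using assms(3) t by (simp add: ln_ge_iff)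
  have sq: "(t powr (1 - (real n - 2 * s) / (2 * \<sigma>)))\<^sup>2 = t powr (2 - (real n - 2 * s) / \<sigma>)"
  proof -
    have "2 * (1 - (real n - 2 * s) / (2 * \<sigma>)) = 2 - (real n - 2 * s) / \<sigma>"
      using assms by (simp add: field_simps)
    then show ?thesis by (simp only: power2_eq_square powr_add[symmetric] mult_2[symmetric])
  qed
  consider "real n < 2 * \<sigma> + 2 * s" | "real n = 2 * \<sigma> + 2 * s" | "real n > 2 * \<sigma> + 2 * s" by linarith
  then have "1 \<le> growth n \<sigma> s t \<and> t powr (2 - (real n - 2 * s) / \<sigma>) \<le> (growth n \<sigma> s t)\<^sup>2"
  proof cases
    case 1
    then show ?thesis using assms t sq by (auto simp: growth_def divide_simps intro!: ge_one_powr_ge_zero)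
  next
    case 2
    then show ?thesis using assms t ln by (auto simp: growth_def)
  next
    case 3
    then show ?thesis using assms t powr_mono[of "2 - (real n - 2 * s) / \<sigma>" 0 t]
      by (auto simp: growth_def divide_simps)
  qed
  then show "1 \<le> growth n \<sigma> s t" "t powr (2 - (real n - 2 * s) / \<sigma>) \<le> (growth n \<sigma> s t)\<^sup>2"
    by auto
qed

text \<open>The two bounds \<open>\<bar>sin u\<bar> \<le> \<bar>u\<bar>\<close> and
  \<open>\<bar>sin u\<bar> \<le> 1\<close> exchange roles at \<open>u = 1\<close>, which determines
  the splitting radius.\<close>

lemma low_frequency_integral_le:
  fixes \<sigma> s :: real
  assumes "\<sigma> \<ge> 1" "s \<ge> 0" and n: "2 * s < real DIM('a::euclidean_space)"
  shows "\<exists>C>0. \<forall>t\<ge>exp 1. (\<integral>\<^sup>+x. ennreal (norm (x :: 'a) powr (- (2 * \<sigma> + 2 * s)) * (sin (norm x powr \<sigma> * t))\<^sup>2)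
        * indicator {0..1} (norm x) \<partial>lebesgue) \<le> ennreal (C * (growth DIM('a) \<sigma> s t)\<^sup>2)"
proof -
  let ?n = "real DIM('a)" and ?w = "sphere_area TYPE('a)" and ?p = "2 * \<sigma> + 2 * s"
  \<comment> \<open>The reciprocal comes from the antiderivative of the power; in the critical case
    \<open>ln (1 / R) = ln t / \<sigma>\<close> gives \<open>1 / \<sigma>\<close> instead.\<close>
  define D where "D = (if ?p = ?n then 1 / \<sigma> else 1 / \<bar>?n - ?p\<bar>)"
  have w: "?w > 0" by (rule sphere_area_pos)
  have D: "D > 0" using assms by (auto simp: D_def)
  have "(\<integral>\<^sup>+x. ennreal (norm (x :: 'a) powr (- ?p) * (sin (norm x powr \<sigma> * t))\<^sup>2) * indicator {0..1} (norm x) \<partial>lebesgue)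
      \<le> ennreal (?w * (1 / (?n - 2 * s) + D) * (growth DIM('a) \<sigma> s t)\<^sup>2)" (is "?I \<le> _") if t: "t \<ge> exp 1" for t
  proof -
    have t1: "t \<ge> 1" "t > 0" using t exp_ge_add_one_self[of 1] by linarith+
    let ?G = "(growth DIM('a) \<sigma> s t)\<^sup>2"
    note g = growth_ge[OF assms(1) n t]
    have G1: "1 \<le> ?G" using g(1) by simp
    define R where "R = t powr (- (1 / \<sigma>))"
    have R: "0 < R" "R \<le> 1" using t1 assms powr_mono[of "- (1 / \<sigma>)" 0 t] by (auto simp: R_def)
    have "?I \<le> (\<integral>\<^sup>+x. ennreal (t\<^sup>2) * (ennreal (norm (x :: 'a) powr (- (2 * s))) * indicator {0..R} (norm x))
        + ennreal (norm x powr (- ?p)) * indicator {R..1} (norm x) \<partial>lebesgue)"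
    proof (intro nn_integral_mono)
      fix x :: 'a
      have small: "norm x powr (- ?p) * (sin (norm x powr \<sigma> * t))\<^sup>2 \<le> t\<^sup>2 * norm x powr (- (2 * s))"
      proof (cases "x = 0")
        case False
        have "(sin (norm x powr \<sigma> * t))\<^sup>2 \<le> (norm x powr \<sigma> * t)\<^sup>2"
          using abs_sin_x_le_abs_x by (simp only: abs_le_square_iff[symmetric])
        then have "norm x powr (- ?p) * (sin (norm x powr \<sigma> * t))\<^sup>2 \<le> norm x powr (- ?p) * (norm x powr \<sigma> * t)\<^sup>2"
          by (intro mult_left_mono) auto
        also have "\<dots> = t\<^sup>2 * norm x powr (- (2 * s))"
          by (simp add: power2_eq_square ac_simps powr_add[symmetric])
        finally show ?thesis .
      qed simp
      have large: "norm x powr (- ?p) * (sin (norm x powr \<sigma> * t))\<^sup>2 \<le> norm x powr (- ?p)"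
        using sin_squared_eq[of "norm x powr \<sigma> * t"] by (intro mult_left_le) auto
      show "ennreal (norm x powr (- ?p) * (sin (norm x powr \<sigma> * t))\<^sup>2) * indicator {0..1} (norm x)
        \<le> ennreal (t\<^sup>2) * (ennreal (norm x powr (- (2 * s))) * indicator {0..R} (norm x))
          + ennreal (norm x powr (- ?p)) * indicator {R..1} (norm x)"
      proof (cases "norm x \<le> R")
        case True
        then show ?thesis
          using ennreal_leI[OF small] by (auto simp: indicator_def ennreal_mult intro: add_increasing2)
      next
        case False
        then show ?thesis
          using ennreal_leI[OF large] by (auto simp: indicator_def)
      qed
    qed
    also have "\<dots> = ennreal (t\<^sup>2) * ennreal (?w * (R powr (?n - 2 * s) / (?n - 2 * s)))
        + ennreal (?w * (if ?p = ?n then ln (1 / R) else (1 powr (?n - ?p) - R powr (?n - ?p)) / (?n - ?p)))"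
    proof -
      have m: "(\<lambda>x::'a. ennreal (norm x powr (- (2 * s))) * indicator {0..R} (norm x)) \<in> borel_measurable lebesgue"
        "(\<lambda>x::'a. ennreal (norm x powr (- ?p)) * indicator {R..1} (norm x)) \<in> borel_measurable lebesgue"
        "(\<lambda>x::'a. ennreal (t\<^sup>2) * (ennreal (norm x powr (- (2 * s))) * indicator {0..R} (norm x))) \<in> borel_measurable lebesgue"
        by (auto intro!: measurable_completion)
      have "(\<integral>\<^sup>+x. ennreal (t\<^sup>2) * (ennreal (norm (x :: 'a) powr (- (2 * s))) * indicator {0..R} (norm x)) \<partial>lebesgue)
         = ennreal (t\<^sup>2) * ennreal (?w * (R powr (?n - 2 * s) / (?n - 2 * s)))"
        using m(1) R by (subst nn_integral_cmult) (auto simp only: nn_integral_radial_powr_0[OF n] less_imp_le)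
      then show ?thesis using m
        by (subst nn_integral_add) (auto simp only: nn_integral_radial_powr[OF R])
    qed
    also have "ennreal (t\<^sup>2) * ennreal (?w * (R powr (?n - 2 * s) / (?n - 2 * s))) \<le> ennreal (?w * (1 / (?n - 2 * s)) * ?G)"
    proof -
      have "t\<^sup>2 * R powr (?n - 2 * s) = t powr (2 - (?n - 2 * s) / \<sigma>)"
      proof -
        have "t\<^sup>2 = t powr 2" using t1 by simp
        moreover have "2 + - (1 / \<sigma>) * (?n - 2 * s) = 2 - (?n - 2 * s) / \<sigma>" by simp
        ultimately show ?thesis by (simp only: R_def powr_powr powr_add[symmetric])
      qed
      with g(2) have "t\<^sup>2 * R powr (?n - 2 * s) \<le> ?G" by simp
      then have "?w * (1 / (?n - 2 * s)) * (t\<^sup>2 * R powr (?n - 2 * s)) \<le> ?w * (1 / (?n - 2 * s)) * ?G"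
        using w n by (intro mult_left_mono) auto
      then show ?thesis using n w
        by (auto simp: ennreal_mult[symmetric] ac_simps intro!: ennreal_leI)
    qed
    also have "ennreal (?w * (if ?p = ?n then ln (1 / R) else (1 powr (?n - ?p) - R powr (?n - ?p)) / (?n - ?p)))
        \<le> ennreal (?w * D * ?G)"
    proof -
      have "(if ?p = ?n then ln (1 / R) else (1 powr (?n - ?p) - R powr (?n - ?p)) / (?n - ?p)) \<le> D * ?G"
      proof -
        consider "?p = ?n" | "?n - ?p > 0" | "?n - ?p < 0" by linarith
        then show ?thesis
        proof cases
          case 1
          have "ln (1 / R) = ln t / \<sigma>" using t1 by (simp add: R_def ln_div ln_powr)
          moreover have "?G = ln t" using 1 assms t1 by (simp add: growth_def)
          ultimately show ?thesis using 1 by (simp add: D_def)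
        next
          case 2
          then have "(1 - R powr (?n - ?p)) / (?n - ?p) \<le> 1 / (?n - ?p)" by (intro divide_right_mono) auto
          also have "\<dots> \<le> D * ?G" using 2 D G1 by (simp add: D_def divide_simps)
          finally show ?thesis using 2 by simp
        next
          case 3
          have "R powr (?n - ?p) = t powr (2 - (?n - 2 * s) / \<sigma>)"
          proof -
            have "- (1 / \<sigma>) * (?n - ?p) = 2 - (?n - 2 * s) / \<sigma>"
              using assms(1) by (simp add: field_simps)
            then show ?thesis by (simp only: R_def powr_powr)
          qed
          then have "R powr (?n - ?p) \<le> ?G" using g(2) by simp
          then have "(R powr (?n - ?p) - 1) / (?p - ?n) \<le> ?G / (?p - ?n)"
            using 3 by (intro divide_right_mono) auto
          also have "\<dots> = D * ?G" using 3 by (simp add: D_def)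
          also have "(R powr (?n - ?p) - 1) / (?p - ?n) = (1 - R powr (?n - ?p)) / (?n - ?p)"
            by (metis minus_diff_eq minus_divide_divide)
          finally show ?thesis using 3 by simp
        qed
      qed
      from mult_left_mono[OF this less_imp_le[OF w]] show ?thesis
        by (simp only: ennreal_leI mult.assoc)
    qed
    also have "ennreal (?w * (1 / (?n - 2 * s)) * ?G) + ennreal (?w * D * ?G) = ennreal (?w * (1 / (?n - 2 * s) + D) * ?G)"
      using w n D by (subst ennreal_plus[symmetric]) (auto simp: algebra_simps)
    finally show ?thesis by (simp add: add_mono)
  qed
  moreover have "?w * (1 / (?n - 2 * s) + D) > 0" using w n D by (auto intro!: mult_pos_pos add_pos_pos)
  ultimately show ?thesis by blast
qed

text \<open>The sign of \<open>?m\<close> decides where the weight concentrates. If negative, at the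
  scale \<open>t powr (- (1 / \<sigma>))\<close>, so a shell of fixed ratio there suffices; if zero,
  all scales from there up to \<open>\<delta>\<close> contribute equally and produce the logarithm;
  if positive, a shell independent of \<open>t\<close> does.\<close>

lemma exists_resonant_shell:
  fixes \<sigma> s \<delta> :: real and n :: nat
  assumes \<sigma>: "\<sigma> \<ge> 1" and "s \<ge> 0" and n: "2 * s < real n" and \<delta>: "\<delta> > 0"
  shows "\<exists>\<kappa>>0. \<exists>T>0. \<forall>t\<ge>T. \<exists>a b c v. 0 < a \<and> a \<le> b \<and> b \<le> \<delta> \<and> c \<ge> 0 \<and>
     (\<forall>r\<in>{a..b}. c \<le> r powr (real n - (2 * \<sigma> + 2 * s))) \<and>
     v \<le> 3 / 16 * ln (b / a) - 1 / (4 * \<sigma> * (a powr \<sigma> * t)) \<and> \<kappa> * (growth n \<sigma> s t)\<^sup>2 \<le> c * v"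
proof -
  let ?m = "real n - (2 * \<sigma> + 2 * s)"
  have aT: "(t powr (- (1 / \<sigma>))) powr \<sigma> * t = 1" if "t > 0" for t
  proof -
    have "- (1 / \<sigma>) * \<sigma> = - 1" using \<sigma> by simp
    then have "(t powr (- (1 / \<sigma>))) powr \<sigma> = t powr (- 1)" by (simp only: powr_powr)
    then show ?thesis using that by (simp add: powr_minus)
  qed
  consider "?m < 0" | "?m = 0" | "?m > 0" by linarith
  then show ?thesis
  proof cases
    case 1
    \<comment> \<open>With ratio \<open>exp 4\<close> the main term is 3/4 and the loss
      \<open>1 / (4 * \<sigma>)\<close> is at most 1/4, which leaves the 1/2 occurring here.
      \<open>T\<close> below ensures that the outer radius is at most
      \<open>\<delta>\<close>.\<close>
    define \<kappa> where "\<kappa> = exp 4 powr ?m / 2"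
    define T where "T = (exp 4 / \<delta>) powr \<sigma>"
    have "\<kappa> > 0" "T > 0" using \<delta> by (auto simp: \<kappa>_def T_def)
    moreover have "\<exists>a b c v. 0 < a \<and> a \<le> b \<and> b \<le> \<delta> \<and> c \<ge> 0 \<and> (\<forall>r\<in>{a..b}. c \<le> r powr ?m) \<and>
       v \<le> 3 / 16 * ln (b / a) - 1 / (4 * \<sigma> * (a powr \<sigma> * t)) \<and> \<kappa> * (growth n \<sigma> s t)\<^sup>2 \<le> c * v" if t: "t \<ge> T" for t
    proof -
      have t0: "t > 0" using t \<open>T > 0\<close> by linarith
      define a where "a = t powr (- (1 / \<sigma>))"
      define b where "b = exp 4 * a"
      have a: "a > 0" "a powr \<sigma> * t = 1" using t0 aT by (auto simp: a_def)
      have "a \<le> T powr (- (1 / \<sigma>))" unfolding a_def using t \<open>T > 0\<close> \<sigma> by (intro powr_mono2') auto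
      also have "\<dots> = \<delta> / exp 4" using \<delta> \<sigma> by (simp add: T_def powr_powr powr_minus)
      finally have b: "b \<le> \<delta>" by (simp add: b_def field_simps)
      have "1 / 2 \<le> 3 / 16 * ln (b / a) - 1 / (4 * \<sigma> * (a powr \<sigma> * t))"
        using a \<sigma> by (simp add: b_def divide_simps)
      moreover have "\<kappa> * (growth n \<sigma> s t)\<^sup>2 \<le> b powr ?m * (1 / 2)"
      proof -
        have "(growth n \<sigma> s t)\<^sup>2 = a powr ?m"
        proof -
          have "2 * (1 - (real n - 2 * s) / (2 * \<sigma>)) = - (1 / \<sigma>) * ?m"
            using \<sigma> by (simp add: field_simps)
          moreover have "growth n \<sigma> s t = t powr (1 - (real n - 2 * s) / (2 * \<sigma>))"
            using 1 n by (simp add: growth_def)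
          ultimately show ?thesis
            by (simp only: a_def powr_powr power2_eq_square powr_add[symmetric] mult_2[symmetric])
        qed
        then show ?thesis using a by (simp add: \<kappa>_def b_def powr_mult)
      qed
      moreover have "\<forall>r\<in>{a..b}. b powr ?m \<le> r powr ?m" using 1 a by (auto intro!: powr_mono2')
      moreover have "a \<le> b" using a by (simp add: b_def)
      ultimately show ?thesis using a b
        by (intro exI[of _ a] exI[of _ b] exI[of _ "b powr ?m"] exI[of _ "1/2"]) auto
    qed
    ultimately show ?thesis by blast
  next
    case 2
    \<comment> \<open>Multiplied by \<open>16 * \<sigma>\<close>, the claim reads
      \<open>2 * ln t \<le> 3 * (\<sigma> * ln \<delta>) + 3 * ln t - 4\<close>.\<close>
    define T where "T = exp (4 + 3 * \<sigma> * \<bar>ln \<delta>\<bar>)"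
    have "1 / (8 * \<sigma>) > 0" "T > 0" using \<sigma> by (auto simp: T_def)
    moreover have "\<exists>a b c v. 0 < a \<and> a \<le> b \<and> b \<le> \<delta> \<and> c \<ge> 0 \<and> (\<forall>r\<in>{a..b}. c \<le> r powr ?m) \<and>
       v \<le> 3 / 16 * ln (b / a) - 1 / (4 * \<sigma> * (a powr \<sigma> * t)) \<and> 1 / (8 * \<sigma>) * (growth n \<sigma> s t)\<^sup>2 \<le> c * v" if t: "t \<ge> T" for t
    proof -
      have t0: "t > 0" using t \<open>T > 0\<close> by linarith
      define a where "a = t powr (- (1 / \<sigma>))"
      have a: "a > 0" "a powr \<sigma> * t = 1" using t0 aT by (auto simp: a_def)
      have lnt: "ln t \<ge> 4 + 3 * \<sigma> * \<bar>ln \<delta>\<bar>" using t t0 by (simp add: T_def ln_ge_iff)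
      have sl: "\<sigma> * \<bar>ln \<delta>\<bar> \<ge> 0" "- (\<sigma> * ln \<delta>) \<le> \<sigma> * \<bar>ln \<delta>\<bar>" using \<sigma> by (auto simp: abs_if mult_le_0_iff zero_le_mult_iff)
      have lna: "ln a = - (ln t / \<sigma>)" using t0 by (simp add: a_def ln_powr)
      have "- (\<sigma> * ln \<delta>) \<le> ln t" using lnt sl by linarith
      then have "- ln t / \<sigma> \<le> ln \<delta>" using \<sigma> by (simp add: field_simps)
      then have "ln a \<le> ln \<delta>" by (simp add: lna)
      then have le: "a \<le> \<delta>" using a \<delta> by simp
      have "ln t \<ge> 0" using lnt sl by linarith
      then have G: "(growth n \<sigma> s t)\<^sup>2 = ln t" using 2 n by (simp add: growth_def)
      have "(3 / 16 * (ln \<delta> - ln a) - 1 / (4 * \<sigma>)) * (16 * \<sigma>) = 3 * (\<sigma> * ln \<delta>) + 3 * ln t - 4"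
        using \<sigma> by (simp add: lna field_simps)
      moreover have "1 / (8 * \<sigma>) * ln t * (16 * \<sigma>) = 2 * ln t"
        using \<sigma> by simp
      ultimately have "1 / (8 * \<sigma>) * ln t * (16 * \<sigma>) \<le> (3 / 16 * (ln \<delta> - ln a) - 1 / (4 * \<sigma>)) * (16 * \<sigma>)"
        using lnt sl by linarith
      then have "1 / (8 * \<sigma>) * ln t \<le> 3 / 16 * (ln \<delta> - ln a) - 1 / (4 * \<sigma>)"
        using \<sigma> by (simp only: mult_le_cancel_right_pos)
      then have "1 / (8 * \<sigma>) * ln t \<le> 3 / 16 * ln (\<delta> / a) - 1 / (4 * \<sigma> * (a powr \<sigma> * t))"
        using a \<delta> by (simp add: ln_div)
      moreover have "\<forall>r\<in>{a..\<delta>}. 1 \<le> r powr ?m" using 2 a by auto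
      ultimately show ?thesis using a le G
        by (intro exI[of _ a] exI[of _ \<delta>] exI[of _ 1] exI[of _ "1 / (8 * \<sigma>) * ln t"]) auto
    qed
    ultimately show ?thesis by blast
  next
    case 3
    \<comment> \<open>Ratio \<open>exp 1\<close> gives the main term 3/16, and \<open>T\<close>
      keeps the loss at most 1/16; the difference is 1/8.\<close>
    define a where "a = \<delta> / exp 1"
    define T where "T = 4 / (\<sigma> * a powr \<sigma>)"
    have a: "a > 0" "a \<le> \<delta>" using \<delta> by (auto simp: a_def divide_simps)
    have "a powr ?m / 8 > 0" "T > 0" using \<sigma> a by (auto simp: T_def)
    \<comment> \<open>\<open>d\<close> names the fixed inner radius, since \<open>a\<close> is bound
      by the quantifier.\<close>
    moreover have "\<exists>a b c v. 0 < a \<and> a \<le> b \<and> b \<le> \<delta> \<and> c \<ge> 0 \<and> (\<forall>r\<in>{a..b}. c \<le> r powr ?m) \<and>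
       v \<le> 3 / 16 * ln (b / a) - 1 / (4 * \<sigma> * (a powr \<sigma> * t)) \<and> d powr ?m / 8 * (growth n \<sigma> s t)\<^sup>2 \<le> c * v"
      if t: "t \<ge> T" and d: "d = a" for t d
    proof -
      have t0: "t > 0" using t \<open>T > 0\<close> by linarith
      have "ln (\<delta> / a) = 1" using \<delta> by (simp add: a_def)
      moreover have "1 / (4 * \<sigma> * (a powr \<sigma> * t)) \<le> 1 / 16"
        using t t0 \<sigma> a by (simp add: T_def field_simps)
      ultimately have "1 / 8 \<le> 3 / 16 * ln (\<delta> / a) - 1 / (4 * \<sigma> * (a powr \<sigma> * t))" by simp
      moreover have "\<forall>r\<in>{a..\<delta>}. a powr ?m \<le> r powr ?m" using 3 a by (auto intro!: powr_mono2)
      moreover have "growth n \<sigma> s t = 1" using 3 by (simp add: growth_def)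
      ultimately show ?thesis using a d
        by (intro exI[of _ a] exI[of _ \<delta>] exI[of _ "a powr ?m"] exI[of _ "1 / 8"]) auto
    qed
    ultimately show ?thesis by blast
  qed
qed

subsection \<open>The three parts of the theorem\<close>

lemma cmod_fourier_L1_le: "cmod (fourier_L1 f \<xi>) \<le> (\<integral>x. cmod (f x) \<partial>lebesgue)"
  unfolding fourier_L1_def by (rule norm_integral_cis_le)

lemma cmod_cis_minus_1_le: "cmod (cis u - 1) \<le> \<bar>u\<bar>"
  using dist_exp_i_1[of u] abs_sin_x_le_abs_x[of "u / 2"] by (simp add: cis_conv_exp mult.commute)

text \<open>The transform at the origin is the total mass, and since
  \<open>\<bar>cis u - 1\<bar> \<le> \<bar>u\<bar>\<close> the weighted integral bounds its
  variation linearly in the distance from there.\<close>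

lemma fourier_L1_near_0:
  fixes g :: "'a::euclidean_space \<Rightarrow> complex"
  assumes g: "g \<in> L11" and P: "total_mass g \<noteq> 0"
  shows "\<exists>\<delta>>0. \<forall>\<xi>. norm \<xi> \<le> \<delta> \<longrightarrow> cmod (total_mass g) / 2 \<le> cmod (fourier_L1 g \<xi>)"
proof -
  have gi: "integrable lebesgue g" and [measurable]: "g \<in> borel_measurable lebesgue"
    using g by (auto simp: L11_def L1_iff_integrable)
  have wi: "integrable lebesgue (\<lambda>x. complex_of_real (1 + norm x) * g x)"
    using g by (auto simp: L11_def L1_norm_def integrable_iff_bounded)
  define B where "B = (\<integral>x. cmod (complex_of_real (1 + norm x) * g x) \<partial>lebesgue)"
  have B: "B \<ge> 0" by (simp add: B_def)
  have lip: "cmod (fourier_L1 g \<xi> - total_mass g) \<le> norm \<xi> * B" for \<xi>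
  proof -
    have di: "integrable lebesgue (\<lambda>x. cis (- (x \<bullet> \<xi>)) * g x - g x)"
      by (intro Bochner_Integration.integrable_diff integrable_cis_mult gi) measurable
    have "fourier_L1 g \<xi> - total_mass g = (\<integral>x. cis (- (x \<bullet> \<xi>)) * g x - g x \<partial>lebesgue)"
      unfolding fourier_L1_def total_mass_def
      by (intro Bochner_Integration.integral_diff[symmetric] integrable_cis_mult gi) measurable
    then have "cmod (fourier_L1 g \<xi> - total_mass g) \<le> (\<integral>x. cmod (cis (- (x \<bullet> \<xi>)) * g x - g x) \<partial>lebesgue)"
      by simp
    also have "\<dots> \<le> (\<integral>x. norm \<xi> * cmod (complex_of_real (1 + norm x) * g x) \<partial>lebesgue)"
    proof (rule integral_mono)
      fix x :: 'a
      have "cmod (cis (- (x \<bullet> \<xi>)) - 1) \<le> \<bar>- (x \<bullet> \<xi>)\<bar>" by (rule cmod_cis_minus_1_le)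
      also have "\<dots> \<le> norm x * norm \<xi>" using Cauchy_Schwarz_ineq2[of x \<xi>] by simp
      also have "\<dots> \<le> norm \<xi> * cmod (complex_of_real (1 + norm x))"
        by (simp only: norm_of_real) (simp add: distrib_left mult.commute)
      finally have "cmod (cis (- (x \<bullet> \<xi>)) - 1) * cmod (g x) \<le> norm \<xi> * cmod (complex_of_real (1 + norm x)) * cmod (g x)"
        by (rule mult_right_mono) simp
      then show "cmod (cis (- (x \<bullet> \<xi>)) * g x - g x) \<le> norm \<xi> * cmod (complex_of_real (1 + norm x) * g x)"
        by (simp only: norm_mult[symmetric] left_diff_distrib mult_1_left) (simp only: norm_mult mult.assoc)
    qed (use di wi in auto)
    finally show ?thesis by (simp add: B_def)
  qed
  \<comment> \<open>\<open>B + 1\<close> rather than \<open>B\<close> keeps the divisor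
    positive.\<close>
  define \<delta> where "\<delta> = cmod (total_mass g) / 2 / (B + 1)"
  have "\<delta> > 0" using P B by (simp add: \<delta>_def)
  moreover have "cmod (total_mass g) / 2 \<le> cmod (fourier_L1 g \<xi>)" if "norm \<xi> \<le> \<delta>" for \<xi>
  proof -
    have "norm \<xi> * B \<le> \<delta> * (B + 1)" using that B \<open>\<delta> > 0\<close> by (intro mult_mono) auto
    also have "\<dots> = cmod (total_mass g) / 2"
      using B \<delta>_def nonzero_eq_divide_eq[of "B + 1" \<delta> "cmod (total_mass g) / 2"] by linarith
    finally have "cmod (total_mass g - fourier_L1 g \<xi>) \<le> cmod (total_mass g) / 2"
      using lip[of \<xi>] by (simp add: norm_minus_commute)
    then show ?thesis using norm_triangle_sub[of "total_mass g" "fourier_L1 g \<xi>"] by simp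
  qed
  ultimately show ?thesis by blast
qed

definition velocity_part :: "real \<Rightarrow> real \<Rightarrow> ('a::euclidean_space \<Rightarrow> complex) \<Rightarrow> 'a \<Rightarrow> complex" where
  "velocity_part \<sigma> t w1_hat \<xi> = complex_of_real (sin (norm \<xi> powr \<sigma> * t) / norm \<xi> powr \<sigma>) * w1_hat \<xi>"

lemma wave_hat_eq: "wave_hat \<sigma> w0 w1_hat t \<xi> =
    complex_of_real (cos (norm \<xi> powr \<sigma> * t)) * fourier_L2 w0 \<xi> + velocity_part \<sigma> t w1_hat \<xi>"
  by (simp add: wave_hat_def velocity_part_def)

lemma fourier_L2_in_L2: "f \<in> L2 \<Longrightarrow> fourier_L2 f \<in> L2"
  using has_fourier_L2_fourier_L2 by (auto simp: has_fourier_L2_def)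

lemma velocity_part_measurable [measurable]:
  assumes [measurable]: "w1_hat \<in> borel_measurable lebesgue"
  shows "velocity_part \<sigma> t w1_hat \<in> borel_measurable lebesgue"
  unfolding velocity_part_def by measurable

text \<open>Division by \<open>norm \<xi> powr s\<close> eliminates \<open>w1_hat\<close> in favour
  of the transform of \<open>g\<close>. This requires \<open>\<xi> \<noteq> 0\<close>, which is
  recorded for later use as well.\<close>

lemma AE_cmod_velocity_part:
  assumes "frac_grad s w1_hat g"
  shows "AE \<xi> in lebesgue. \<xi> \<noteq> 0 \<and>
    cmod (velocity_part \<sigma> t w1_hat \<xi>) = \<bar>sin (norm \<xi> powr \<sigma> * t)\<bar> * (norm \<xi> powr (- (\<sigma> + s)) * cmod (fourier_L1 g \<xi>))"
proof -
  have 0: "AE \<xi> in lebesgue. \<xi> \<noteq> (0 :: 'a)"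
    by (intro AE_completion AE_lborel_singleton)
  have "AE \<xi> in lebesgue. complex_of_real (norm \<xi> powr s) * w1_hat \<xi> = fourier_L1 g \<xi>"
    using assms by (simp add: frac_grad_def)
  with 0 show ?thesis
  proof eventually_elim
    fix \<xi> :: 'a assume \<xi>: "\<xi> \<noteq> 0" and eq: "complex_of_real (norm \<xi> powr s) * w1_hat \<xi> = fourier_L1 g \<xi>"
    have "cmod (fourier_L1 g \<xi>) = norm \<xi> powr s * cmod (w1_hat \<xi>)"
      unfolding eq[symmetric] by (simp add: norm_mult)
    then show "\<xi> \<noteq> 0 \<and> cmod (velocity_part \<sigma> t w1_hat \<xi>)
        = \<bar>sin (norm \<xi> powr \<sigma> * t)\<bar> * (norm \<xi> powr (- (\<sigma> + s)) * cmod (fourier_L1 g \<xi>))"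
      using \<xi> by (simp add: velocity_part_def norm_mult norm_divide powr_diff powr_minus divide_simps)
  qed
qed

lemma sq_norm_velocity_part_le:
  fixes w1_hat g :: "'a::euclidean_space \<Rightarrow> complex"
  assumes fg: "frac_grad s w1_hat g" and "\<sigma> \<ge> 0" "s \<ge> 0"
  shows "sq_norm (velocity_part \<sigma> t w1_hat) \<le> (L1_norm g * L1_norm g) *
     (\<integral>\<^sup>+x. ennreal (norm (x :: 'a) powr (- (2 * \<sigma> + 2 * s)) * (sin (norm x powr \<sigma> * t))\<^sup>2) * indicator {0..1} (norm x) \<partial>lebesgue)
     + ennreal ((2 * pi) ^ DIM('a)) * sq_norm g"
proof -
  let ?h = "\<lambda>x::'a. ennreal (norm x powr (- (2 * \<sigma> + 2 * s)) * (sin (norm x powr \<sigma> * t))\<^sup>2) * indicator {0..1} (norm x)"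
  have g: "g \<in> L1" using fg by (simp add: frac_grad_def)
  then have [measurable]: "fourier_L1 g \<in> borel_measurable lebesgue" by (rule fourier_L1_measurable)
  have [measurable]: "?h \<in> borel_measurable lebesgue" by (auto intro!: measurable_completion)
  define L where "L = (\<integral>x. cmod (g x) \<partial>lebesgue)"
  have L0: "L \<ge> 0" by (simp add: L_def)
  have L: "L1_norm g = ennreal L"
    unfolding L_def L1_norm_def using g by (intro nn_integral_eq_integral) (auto simp: L1_iff_integrable)
  \<comment> \<open>The second summand is kept at all frequencies, so that \<open>bessel\<close>
    bounds it on the whole space.\<close>
  have "sq_norm (velocity_part \<sigma> t w1_hat) \<le> (\<integral>\<^sup>+x. ennreal (L * L) * ?h x + ennreal ((cmod (fourier_L1 g x))\<^sup>2) \<partial>lebesgue)"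
    unfolding sq_norm_def using AE_cmod_velocity_part[OF fg, of \<sigma> t]
  proof (intro nn_integral_mono_AE, eventually_elim)
    fix \<xi> :: 'a assume *: "\<xi> \<noteq> 0 \<and>
      cmod (velocity_part \<sigma> t w1_hat \<xi>) = \<bar>sin (norm \<xi> powr \<sigma> * t)\<bar> * (norm \<xi> powr (- (\<sigma> + s)) * cmod (fourier_L1 g \<xi>))"
    have "- (2 * \<sigma> + 2 * s) = - (\<sigma> + s) + - (\<sigma> + s)" by simp
    then have pp: "norm \<xi> powr (- (2 * \<sigma> + 2 * s)) = (norm \<xi> powr (- (\<sigma> + s)))\<^sup>2"
      by (simp only: powr_add power2_eq_square)
    have sq: "(cmod (velocity_part \<sigma> t w1_hat \<xi>))\<^sup>2
      = (norm \<xi> powr (- (2 * \<sigma> + 2 * s)) * (sin (norm \<xi> powr \<sigma> * t))\<^sup>2) * (cmod (fourier_L1 g \<xi>))\<^sup>2"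
      using * unfolding pp by (simp add: power_mult_distrib ac_simps)
    show "ennreal ((cmod (velocity_part \<sigma> t w1_hat \<xi>))\<^sup>2) \<le> ennreal (L * L) * ?h \<xi> + ennreal ((cmod (fourier_L1 g \<xi>))\<^sup>2)"
    proof (cases "norm \<xi> \<le> 1")
      case True
      have "(cmod (fourier_L1 g \<xi>))\<^sup>2 \<le> L * L"
        using cmod_fourier_L1_le[of g \<xi>] unfolding L_def power2_eq_square by (intro mult_mono) auto
      then have "(cmod (velocity_part \<sigma> t w1_hat \<xi>))\<^sup>2
          \<le> (norm \<xi> powr (- (2 * \<sigma> + 2 * s)) * (sin (norm \<xi> powr \<sigma> * t))\<^sup>2) * (L * L)"
        unfolding sq by (intro mult_left_mono) auto
      from ennreal_leI[OF this] have "ennreal ((cmod (velocity_part \<sigma> t w1_hat \<xi>))\<^sup>2) \<le> ennreal (L * L) * ?h \<xi>"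
        using True L0 by (simp add: ennreal_mult[symmetric] ac_simps)
      then show ?thesis by (rule add_increasing2[rotated]) simp
    next
      case False
      have "norm \<xi> powr (- (2 * \<sigma> + 2 * s)) \<le> norm \<xi> powr 0"
        using False assms by (intro powr_mono) auto
      then have "norm \<xi> powr (- (2 * \<sigma> + 2 * s)) \<le> 1" using * by simp
      moreover have "(sin (norm \<xi> powr \<sigma> * t))\<^sup>2 \<le> 1" by (simp add: sin_squared_eq)
      ultimately have "norm \<xi> powr (- (2 * \<sigma> + 2 * s)) * (sin (norm \<xi> powr \<sigma> * t))\<^sup>2 \<le> 1 * 1"
        by (intro mult_mono) auto
      then have "(cmod (velocity_part \<sigma> t w1_hat \<xi>))\<^sup>2 \<le> 1 * (cmod (fourier_L1 g \<xi>))\<^sup>2"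
        unfolding sq by (intro mult_right_mono) auto
      then have "ennreal ((cmod (velocity_part \<sigma> t w1_hat \<xi>))\<^sup>2) \<le> ennreal ((cmod (fourier_L1 g \<xi>))\<^sup>2)"
        by (intro ennreal_leI) simp
      then show ?thesis by (rule add_increasing[rotated]) simp
    qed
  qed
  also have "\<dots> = (L1_norm g * L1_norm g) * (\<integral>\<^sup>+x. ?h x \<partial>lebesgue) + sq_norm (fourier_L1 g)"
    by (subst nn_integral_add) (auto simp: nn_integral_cmult sq_norm_def L ennreal_mult L0)
  also have "\<dots> \<le> (L1_norm g * L1_norm g) * (\<integral>\<^sup>+x. ?h x \<partial>lebesgue) + ennreal ((2 * pi) ^ DIM('a)) * sq_norm g"
    using bessel[OF g] by (intro add_left_mono) (simp add: sq_norm_def)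
  finally show ?thesis .
qed

text \<open>The cross terms are nonnegative surplus. It turns bounds on squares back into a bound by
  the sum of the norms.\<close>

lemma square_sum3_le:
  fixes a b c :: ennreal
  shows "a * a + (b * b + c * c) \<le> (a + (b + c)) * (a + (b + c))"
proof -
  have "(a + (b + c)) * (a + (b + c)) = (a * a + (b * b + c * c)) + ((a * b + a * b) + (a * c + a * c) + (b * c + b * c))"
    by (simp only: distrib_left distrib_right ac_simps)
  then show ?thesis by (metis le_iff_add)
qed

section \<open>The upper bound\<close>

lemma wave_upper:
  fixes \<sigma> s :: real
  assumes "\<sigma> \<ge> 1" and "s \<ge> 0" and n: "2 * s < real DIM('a::euclidean_space)"
  shows "\<exists>C>0. \<exists>T>0. \<forall>(w0 :: 'a \<Rightarrow> complex) w1_hat g.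
          w0 \<in> L2 \<and> frac_grad s w1_hat g \<and> g \<in> L2 \<inter> L1 \<longrightarrow>
          (\<forall>t\<ge>T. wave_L2_norm \<sigma> w0 w1_hat t
                   \<le> ennreal (C * growth DIM('a) \<sigma> s t) *
                     (L2_norm w0 + (L2_norm g + L1_norm g)))"
proof -
  obtain D where D: "D > 0" and I: "\<And>t. t \<ge> exp 1 \<Longrightarrow>
     (\<integral>\<^sup>+x. ennreal (norm (x :: 'a) powr (- (2 * \<sigma> + 2 * s)) * (sin (norm x powr \<sigma> * t))\<^sup>2)
        * indicator {0..1} (norm x) \<partial>lebesgue) \<le> ennreal (D * (growth DIM('a) \<sigma> s t)\<^sup>2)"
    using low_frequency_integral_le[OF assms] by blast
  define c where "c = (2 * pi) ^ DIM('a)"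
  have c: "c > 0" by (simp add: c_def)
  \<comment> \<open>\<open>8 * c\<close> is twice the constant of
    \<open>sq_norm_fourier_L2_le\<close>, and \<open>2 * D\<close> comes from the low frequencies;
    the coefficient \<open>2 * c\<close> of \<open>sq_norm g\<close> is covered too.\<close>
  define K where "K = 8 * c + 2 * D"
  have K: "K > 0" using c D by (simp add: K_def)
  define q where "q = (2 * pi) powr (- real DIM('a) / 2)"
  have q: "q > 0" by (simp add: q_def)
  have "wave_L2_norm \<sigma> w0 w1_hat t \<le> ennreal (q * sqrt K * growth DIM('a) \<sigma> s t) * (L2_norm w0 + (L2_norm g + L1_norm g))"
    if w0: "w0 \<in> L2" and fg: "frac_grad s w1_hat g" and t: "t \<ge> exp 1"
    for w0 w1_hat g :: "'a \<Rightarrow> complex" and t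
  proof -
    let ?G = "growth DIM('a) \<sigma> s t" and ?X = "L2_norm w0 + (L2_norm g + L1_norm g)"
    have G: "?G \<ge> 1" by (rule growth_ge(1)[OF assms(1) n t])
    then have G2: "?G\<^sup>2 \<ge> 1" by simp
    have [measurable]: "w1_hat \<in> borel_measurable lebesgue" using fg by (simp add: frac_grad_def)
    have [measurable]: "fourier_L2 w0 \<in> borel_measurable lebesgue"
      using fourier_L2_in_L2[OF w0] by (simp add: L2_def)
    have "sq_norm (wave_hat \<sigma> w0 w1_hat t) \<le> 2 * sq_norm (fourier_L2 w0) + 2 * sq_norm (velocity_part \<sigma> t w1_hat)"
      unfolding wave_hat_eq
    proof (intro sq_norm_bound AE_I2)
      fix \<xi> :: 'a
      have "cmod (complex_of_real (cos (norm \<xi> powr \<sigma> * t)) * fourier_L2 w0 \<xi>) \<le> cmod (fourier_L2 w0 \<xi>)"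
        by (simp add: norm_mult mult_left_le_one_le)
      then show "cmod (complex_of_real (cos (norm \<xi> powr \<sigma> * t)) * fourier_L2 w0 \<xi> + velocity_part \<sigma> t w1_hat \<xi>)
         \<le> cmod (fourier_L2 w0 \<xi>) + cmod (velocity_part \<sigma> t w1_hat \<xi>)"
        by (intro norm_triangle_le) simp
    qed auto
    also have "\<dots> \<le> 2 * (ennreal (4 * c) * sq_norm w0)
        + 2 * ((L1_norm g * L1_norm g) * ennreal (D * ?G\<^sup>2) + ennreal c * sq_norm g)"
      using assms sq_norm_fourier_L2_le[OF w0, folded c_def]
      by (intro add_mono mult_left_mono order_trans[OF sq_norm_velocity_part_le[OF fg, folded c_def]] I t) auto
    also have "\<dots> = ennreal (8 * c) * sq_norm w0 + (ennreal (2 * c) * sq_norm g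
        + ennreal (2 * D * ?G\<^sup>2) * (L1_norm g * L1_norm g))"
    proof -
      have "2 * ennreal (4 * c) = ennreal (8 * c)" "2 * ennreal c = ennreal (2 * c)"
        "2 * ennreal (D * ?G\<^sup>2) = ennreal (2 * D * ?G\<^sup>2)"
        using c D by (simp_all add: ennreal_numeral[symmetric] ennreal_mult'[symmetric] mult.assoc del: ennreal_numeral)
      then show ?thesis by (simp only: distrib_left mult.assoc[symmetric]) (simp only: ac_simps)
    qed
    also have "\<dots> \<le> ennreal (K * ?G\<^sup>2) * sq_norm w0 + (ennreal (K * ?G\<^sup>2) * sq_norm g
        + ennreal (K * ?G\<^sup>2) * (L1_norm g * L1_norm g))"
    proof -
      have "K * 1 \<le> K * ?G\<^sup>2" using K G2 by (intro mult_left_mono) auto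
      moreover have "2 * D * ?G\<^sup>2 \<le> K * ?G\<^sup>2" using c by (intro mult_right_mono) (auto simp: K_def)
      moreover have "8 * c \<le> K" "2 * c \<le> K" using c D by (auto simp: K_def)
      ultimately have "8 * c \<le> K * ?G\<^sup>2" "2 * c \<le> K * ?G\<^sup>2" "2 * D * ?G\<^sup>2 \<le> K * ?G\<^sup>2" by linarith+
      then show ?thesis using c
        by (intro add_mono mult_right_mono ennreal_leI) (assumption | simp add: K_def)+
    qed
    also have "\<dots> = ennreal (K * ?G\<^sup>2) * (L2_norm w0 * L2_norm w0 + (L2_norm g * L2_norm g + L1_norm g * L1_norm g))"
      by (simp only: L2_norm_square distrib_left)
    also have "\<dots> \<le> ennreal (K * ?G\<^sup>2) * (?X * ?X)"
      by (intro mult_left_mono square_sum3_le) simp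
    also have "\<dots> = (ennreal (sqrt K * ?G) * ?X) * (ennreal (sqrt K * ?G) * ?X)"
    proof -
      have "ennreal (K * ?G\<^sup>2) = ennreal (sqrt K * ?G) * ennreal (sqrt K * ?G)"
        using K G by (simp add: ennreal_mult[symmetric] power2_eq_square)
      then show ?thesis by (simp only: ac_simps)
    qed
    finally have "L2_norm (wave_hat \<sigma> w0 w1_hat t) \<le> ennreal (sqrt K * ?G) * ?X" by (rule L2_norm_leI)
    then have "ennreal q * L2_norm (wave_hat \<sigma> w0 w1_hat t) \<le> ennreal q * (ennreal (sqrt K * ?G) * ?X)"
      by (rule mult_left_mono) simp
    also have "\<dots> = ennreal (q * sqrt K * ?G) * ?X"
      using q by (simp only: mult.assoc[symmetric] ennreal_mult'[symmetric, OF less_imp_le])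
    finally show ?thesis by (simp add: wave_L2_norm_def q_def)
  qed
  moreover have "q * sqrt K > 0" using q K by simp
  ultimately show ?thesis by (intro exI[of _ "q * sqrt K"] conjI exI[of _ "exp 1"]) auto
qed

section \<open>The lower bound\<close>

text \<open>Absorbing \<open>A \<le> B / 4\<close> gives
  \<open>B * (\<bar>S\<bar> - 1/4) \<le> W\<close>. The square (\<bar>S\<bar> - 1/4)^2 exceeds S^2 /
  2 - 1/16 by (\<bar>S\<bar> - 1/2)^2 / 2, and where \<open>\<bar>S\<bar> \<le> 1/4\<close> the
  maximum is 0.\<close>

lemma low_frequency_dominance:
  fixes S A B :: real
  assumes "4 * A \<le> B" "A \<ge> 0" "\<bar>S\<bar> * B \<le> W + A"
  shows "B\<^sup>2 * max 0 (S\<^sup>2 / 2 - 1 / 16) \<le> W\<^sup>2"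
proof (cases "\<bar>S\<bar> \<le> 1 / 4")
  case True
  then have "S\<^sup>2 \<le> (1/4)\<^sup>2" by (simp only: abs_le_square_iff[symmetric])
  then show ?thesis by (simp add: power2_eq_square max_def)
next
  case False
  have "0 \<le> B * (\<bar>S\<bar> - 1/4)" using False assms by (intro mult_nonneg_nonneg) auto
  moreover have "B * (\<bar>S\<bar> - 1/4) \<le> W" using assms by (simp add: algebra_simps)
  ultimately have W: "(B * (\<bar>S\<bar> - 1/4))\<^sup>2 \<le> W\<^sup>2" by (intro power_mono)
  have "0 \<le> (\<bar>S\<bar> - 1/2)\<^sup>2" by simp
  then have "S\<^sup>2 / 2 - 1 / 16 \<le> (\<bar>S\<bar> - 1/4)\<^sup>2" by (simp add: power2_diff field_simps)
  then have "max 0 (S\<^sup>2 / 2 - 1 / 16) \<le> (\<bar>S\<bar> - 1/4)\<^sup>2" by simp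
  then have "B\<^sup>2 * max 0 (S\<^sup>2 / 2 - 1 / 16) \<le> B\<^sup>2 * (\<bar>S\<bar> - 1/4)\<^sup>2" by (rule mult_left_mono) simp
  with W show ?thesis by (simp add: power_mult_distrib)
qed

lemma wave_lower:
  fixes \<sigma> s :: real and w0 w1_hat g :: "'a::euclidean_space \<Rightarrow> complex"
  assumes "\<sigma> \<ge> 1" and "s \<ge> 0" and n: "2 * s < real DIM('a)"
    and w0: "w0 \<in> L2 \<inter> L1" and fg: "frac_grad s w1_hat g" and g: "g \<in> L11" and P: "total_mass g \<noteq> 0"
  shows "\<exists>c>0. \<exists>T>0. \<forall>t\<ge>T. wave_L2_norm \<sigma> w0 w1_hat t \<ge> ennreal (c * growth DIM('a) \<sigma> s t * cmod (total_mass g))"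
proof -
  let ?P = "cmod (total_mass g)" and ?w = "sphere_area TYPE('a)" and ?p = "2 * \<sigma> + 2 * s"
  have w: "?w > 0" by (rule sphere_area_pos)
  have Ppos: "?P > 0" using P by simp
  obtain \<delta>0 where \<delta>0: "\<delta>0 > 0" "\<And>\<xi>. norm \<xi> \<le> \<delta>0 \<Longrightarrow> ?P / 2 \<le> cmod (fourier_L1 g \<xi>)"
    using fourier_L1_near_0[OF g P] by blast
  define M where "M = (\<integral>x. cmod (w0 x) \<partial>lebesgue)"
  have M: "M \<ge> 0" by (simp add: M_def)
  \<comment> \<open>The second entry enforces \<open>4 * M \<le> B\<close> in
    \<open>low_frequency_dominance\<close>: 8 is that 4 times the 2 from halving the mass, and
    \<open>M + 1\<close> keeps the divisor positive.\<close>
  define \<delta> where "\<delta> = min \<delta>0 ((?P / (8 * (M + 1))) powr (1 / (\<sigma> + s)))"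
  have \<delta>: "\<delta> > 0" using \<delta>0 Ppos M by (simp add: \<delta>_def)
  have big: "4 * M \<le> ?P / 2 * r powr (- (\<sigma> + s))" if "0 < r" "r \<le> \<delta>" for r
  proof -
    have "r powr (\<sigma> + s) \<le> ((?P / (8 * (M + 1))) powr (1 / (\<sigma> + s))) powr (\<sigma> + s)"
      using that assms by (intro powr_mono2) (auto simp: \<delta>_def)
    also have "\<dots> = ?P / (8 * (M + 1))" using assms Ppos M by (simp add: powr_powr)
    finally have "(8 * (M + 1)) * r powr (\<sigma> + s) \<le> ?P" using M by (simp add: field_simps)
    then have "8 * (M + 1) \<le> ?P / r powr (\<sigma> + s)" using that by (simp add: field_simps)
    then have "8 * (M + 1) / 2 \<le> ?P / r powr (\<sigma> + s) / 2" by (rule divide_right_mono) simp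
    also have "\<dots> = ?P / 2 * r powr (- (\<sigma> + s))"
      by (simp only: powr_minus_divide) simp
    finally show ?thesis by (rule order_trans[rotated]) simp
  qed
  have F: "AE \<xi> in lebesgue. fourier_L2 w0 \<xi> = fourier_L1 w0 \<xi>"
    using w0 by (intro fourier_L2_eq_fourier_L1) auto
  have low: "AE \<xi> in lebesgue. norm \<xi> \<le> \<delta> \<longrightarrow>
     (?P / 2)\<^sup>2 * (norm \<xi> powr (- ?p) * osc \<sigma> t (norm \<xi>)) \<le> (cmod (wave_hat \<sigma> w0 w1_hat t \<xi>))\<^sup>2" for t
    using AE_cmod_velocity_part[OF fg, of \<sigma> t] F
  proof (eventually_elim, intro impI)
    fix \<xi> :: 'a
    let ?S = "sin (norm \<xi> powr \<sigma> * t)" and ?B = "?P / 2 * norm \<xi> powr (- (\<sigma> + s))"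
    assume v: "\<xi> \<noteq> 0 \<and> cmod (velocity_part \<sigma> t w1_hat \<xi>)
        = \<bar>?S\<bar> * (norm \<xi> powr (- (\<sigma> + s)) * cmod (fourier_L1 g \<xi>))"
      and f: "fourier_L2 w0 \<xi> = fourier_L1 w0 \<xi>" and le: "norm \<xi> \<le> \<delta>"
    have "cmod (complex_of_real (cos (norm \<xi> powr \<sigma> * t)) * fourier_L2 w0 \<xi>) \<le> cmod (fourier_L1 w0 \<xi>)"
      by (simp add: norm_mult mult_left_le_one_le f)
    also have "\<dots> \<le> M" unfolding M_def by (rule cmod_fourier_L1_le)
    finally have A: "cmod (complex_of_real (cos (norm \<xi> powr \<sigma> * t)) * fourier_L2 w0 \<xi>) \<le> M" .
    have "?B \<le> norm \<xi> powr (- (\<sigma> + s)) * cmod (fourier_L1 g \<xi>)"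
    proof -
      have "norm \<xi> \<le> \<delta>0" using le by (simp add: \<delta>_def)
      from mult_left_mono[OF \<delta>0(2)[OF this], of "norm \<xi> powr (- (\<sigma> + s))"] show ?thesis
        by (simp add: mult.commute)
    qed
    then have "\<bar>?S\<bar> * ?B \<le> cmod (velocity_part \<sigma> t w1_hat \<xi>)"
      unfolding conjunct2[OF v] by (rule mult_left_mono) simp
    also have "\<dots> \<le> cmod (wave_hat \<sigma> w0 w1_hat t \<xi>) + M"
      using A norm_triangle_sub[of "velocity_part \<sigma> t w1_hat \<xi>" "wave_hat \<sigma> w0 w1_hat t \<xi>"]
      by (simp add: wave_hat_eq)
    finally have "?B\<^sup>2 * max 0 (?S\<^sup>2 / 2 - 1 / 16) \<le> (cmod (wave_hat \<sigma> w0 w1_hat t \<xi>))\<^sup>2"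
      using v le M by (intro low_frequency_dominance[OF big]) auto
    moreover have "- ?p = - (\<sigma> + s) + - (\<sigma> + s)" by simp
    ultimately show "(?P / 2)\<^sup>2 * (norm \<xi> powr (- ?p) * osc \<sigma> t (norm \<xi>)) \<le> (cmod (wave_hat \<sigma> w0 w1_hat t \<xi>))\<^sup>2"
      by (simp only: powr_add osc_def power2_eq_square mult.assoc mult.left_commute)
  qed
  obtain \<kappa> T where \<kappa>: "\<kappa> > 0" and T: "T > 0" and ex: "\<And>t. t \<ge> T \<Longrightarrow> \<exists>a b c v. 0 < a \<and> a \<le> b \<and> b \<le> \<delta> \<and> c \<ge> 0 \<and>
     (\<forall>r\<in>{a..b}. c \<le> r powr (real DIM('a) - ?p)) \<and>
     v \<le> 3 / 16 * ln (b / a) - 1 / (4 * \<sigma> * (a powr \<sigma> * t)) \<and> \<kappa> * (growth DIM('a) \<sigma> s t)\<^sup>2 \<le> c * v"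
    using exists_resonant_shell[OF assms(1,2) n \<delta>] by blast
  define q where "q = (2 * pi) powr (- real DIM('a) / 2)"
  have q: "q > 0" by (simp add: q_def)
  \<comment> \<open>Fits the identity \<open>(k * ?P)^2 = (?P / 2)^2 * (?w * \<kappa>)\<close>,
    where \<open>?w\<close> stems from polar coordinates.\<close>
  define k where "k = sqrt (?w * \<kappa>) / 2"
  have k: "k > 0" using w \<kappa> by (simp add: k_def)
  \<comment> \<open>The threshold \<open>exp 1\<close> makes the growth factor nonnegative, as
    passing to square roots requires.\<close>
  have "ennreal (q * k * growth DIM('a) \<sigma> s t * ?P) \<le> wave_L2_norm \<sigma> w0 w1_hat t" if t: "t \<ge> max T (exp 1)" for t
  proof -
    let ?G = "growth DIM('a) \<sigma> s t"
    have t0: "t > 0" using t T by auto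
    have G: "?G \<ge> 1" using growth_ge(1)[OF assms(1) n] t by auto
    obtain a b c v where ab: "0 < a" "a \<le> b" "b \<le> \<delta>" and c: "c \<ge> 0"
      "\<And>r. r \<in> {a..b} \<Longrightarrow> c \<le> r powr (real DIM('a) - ?p)"
      and v: "v \<le> 3 / 16 * ln (b / a) - 1 / (4 * \<sigma> * (a powr \<sigma> * t))" and kv: "\<kappa> * ?G\<^sup>2 \<le> c * v"
      using ex[of t] t by auto
    have "(k * ?G * ?P) * (k * ?G * ?P) = (?P / 2)\<^sup>2 * (?w * (\<kappa> * ?G\<^sup>2))"
    proof -
      have "k * k = ?w * \<kappa> / 4" using w \<kappa> by (simp add: k_def)
      moreover have "(k * ?G * ?P) * (k * ?G * ?P) = (k * k) * ?G\<^sup>2 * ?P\<^sup>2" by (simp add: power2_eq_square)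
      ultimately show ?thesis by (simp add: power2_eq_square)
    qed
    also have "\<dots> \<le> (?P / 2)\<^sup>2 * (?w * (c * v))"
      using w kv by (intro mult_left_mono) auto
    finally have "ennreal ((k * ?G * ?P) * (k * ?G * ?P)) \<le> ennreal ((?P / 2)\<^sup>2) * ennreal (?w * c * v)"
      by (subst ennreal_mult'[symmetric]) (auto intro!: ennreal_leI simp: mult.assoc)
    also have "\<dots> \<le> ennreal ((?P / 2)\<^sup>2) *
        (\<integral>\<^sup>+x. ennreal (norm (x :: 'a) powr (- ?p) * osc \<sigma> t (norm x)) * indicator {a..b} (norm x) \<partial>lebesgue)"
      using assms t0 ab c v by (intro mult_left_mono osc_radial_integral_ge) auto
    also have "\<dots> = (\<integral>\<^sup>+x. ennreal ((?P / 2)\<^sup>2) *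
        (ennreal (norm (x :: 'a) powr (- ?p) * osc \<sigma> t (norm x)) * indicator {a..b} (norm x)) \<partial>lebesgue)"
      by (intro nn_integral_cmult[symmetric] measurable_completion) simp
    also have "\<dots> \<le> sq_norm (wave_hat \<sigma> w0 w1_hat t)"
      unfolding sq_norm_def using low[of t]
    proof (intro nn_integral_mono_AE, eventually_elim)
      fix x :: 'a
      assume "norm x \<le> \<delta> \<longrightarrow> (?P / 2)\<^sup>2 * (norm x powr (- ?p) * osc \<sigma> t (norm x)) \<le> (cmod (wave_hat \<sigma> w0 w1_hat t x))\<^sup>2"
      then show "ennreal ((?P / 2)\<^sup>2) * (ennreal (norm x powr (- ?p) * osc \<sigma> t (norm x)) * indicator {a..b} (norm x))
         \<le> ennreal ((cmod (wave_hat \<sigma> w0 w1_hat t x))\<^sup>2)"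
        using ab by (auto simp: indicator_def ennreal_mult'[symmetric] intro!: ennreal_leI)
    qed
    finally have "ennreal (k * ?G * ?P) \<le> L2_norm (wave_hat \<sigma> w0 w1_hat t)"
      using k G by (intro L2_norm_geI) auto
    then have "ennreal q * ennreal (k * ?G * ?P) \<le> wave_L2_norm \<sigma> w0 w1_hat t"
      unfolding wave_L2_norm_def q_def by (rule mult_left_mono) simp
    then show ?thesis using q by (simp add: ennreal_mult'[symmetric] mult.assoc)
  qed
  moreover have "q * k > 0" using q k by simp
  moreover have "max T (exp 1) > 0" using T by simp
  ultimately show ?thesis by blast
qed

section \<open>Infinite norm in low dimensions\<close>

lemma sin_ge_half: "0 \<le> u \<Longrightarrow> u \<le> 1 \<Longrightarrow> u / 2 \<le> sin (u :: real)"
proof -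
  assume u: "0 \<le> u" "u \<le> 1"
  have "(\<lambda>x. sin x - x / 2) 0 \<le> (\<lambda>x. sin x - x / 2) u"
  proof (rule DERIV_nonneg_imp_nondecreasing[OF u(1)])
    fix x assume x: "0 \<le> x" "x \<le> u"
    \<comment> \<open>On \<open>[0, 1]\<close>, which lies inside \<open>[0, pi / 3]\<close>, the
      cosine is at least 1/2.\<close>
    have "cos (pi / 3) \<le> cos x" using x u pi_gt3 by (intro cos_monotone_0_pi_le) auto
    then show "\<exists>y. ((\<lambda>x. sin x - x / 2) has_real_derivative y) (at x) \<and> 0 \<le> y"
      by (intro exI[of _ "cos x - 1 / 2"]) (auto intro!: derivative_eq_intros simp: cos_60)
  qed
  then show ?thesis by simp
qed

text \<open>Where \<open>norm \<xi> powr \<sigma> * t \<le> 1\<close> the sine is at least half its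
  argument, so it cancels the factor \<open>norm \<xi> powr (- \<sigma>)\<close> and only the
  singularity of order \<open>s\<close> remains. Its square is not integrable at the origin.\<close>

lemma wave_infinite:
  fixes \<sigma> s :: real and w0 w1_hat g :: "'a::euclidean_space \<Rightarrow> complex"
  assumes "\<sigma> \<ge> 1" and "s \<ge> 0" and n: "real DIM('a) \<le> 2 * s"
    and w0: "w0 \<in> L2" and fg: "frac_grad s w1_hat g" and g: "g \<in> L11" and P: "total_mass g \<noteq> 0"
    and t: "t > 0"
  shows "wave_L2_norm \<sigma> w0 w1_hat t = \<infinity>"
proof -
  let ?P = "cmod (total_mass g)" and ?v = "velocity_part \<sigma> t w1_hat"
  have Ppos: "?P > 0" using P by simp
  obtain \<delta>0 where \<delta>0: "\<delta>0 > 0" "\<And>\<xi>. norm \<xi> \<le> \<delta>0 \<Longrightarrow> ?P / 2 \<le> cmod (fourier_L1 g \<xi>)"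
    using fourier_L1_near_0[OF g P] by blast
  \<comment> \<open>The radius may depend on \<open>t\<close>, which is fixed; it keeps the argument
    of the sine at most 1.\<close>
  define \<delta> where "\<delta> = min \<delta>0 (t powr (- (1 / \<sigma>)))"
  have \<delta>: "\<delta> > 0" using \<delta>0 t by (simp add: \<delta>_def)
  have [measurable]: "w1_hat \<in> borel_measurable lebesgue" using fg by (simp add: frac_grad_def)
  have F: "fourier_L2 w0 \<in> L2" by (rule fourier_L2_in_L2[OF w0])
  then have [measurable]: "fourier_L2 w0 \<in> borel_measurable lebesgue" by (simp add: L2_def)
  have [measurable]: "wave_hat \<sigma> w0 w1_hat t \<in> borel_measurable lebesgue"
    unfolding wave_hat_def by measurable
  have low: "AE \<xi> in lebesgue. ennreal ((t * ?P / 4)\<^sup>2) * (ennreal (norm \<xi> powr (- (2 * s))) * indicator {0<..\<delta>} (norm \<xi>))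
      \<le> ennreal ((cmod (?v \<xi>))\<^sup>2)"
    using AE_cmod_velocity_part[OF fg, of \<sigma> t]
  proof eventually_elim
    fix \<xi> :: 'a
    let ?u = "norm \<xi> powr \<sigma> * t"
    assume v: "\<xi> \<noteq> 0 \<and> cmod (?v \<xi>) = \<bar>sin ?u\<bar> * (norm \<xi> powr (- (\<sigma> + s)) * cmod (fourier_L1 g \<xi>))"
    have "(t * ?P / 4) * norm \<xi> powr (- s) \<le> cmod (?v \<xi>)" if le: "norm \<xi> \<le> \<delta>"
    proof -
      have "norm \<xi> powr \<sigma> \<le> (t powr (- (1 / \<sigma>))) powr \<sigma>"
        using le assms by (intro powr_mono2) (auto simp: \<delta>_def)
      also have "\<dots> = t powr (- 1)" using assms by (simp add: powr_powr)
      finally have "?u \<le> 1" using t by (simp add: powr_minus field_simps)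
      moreover have "?u \<ge> 0" using t by simp
      ultimately have "?u / 2 \<le> \<bar>sin ?u\<bar>" using sin_ge_half[of ?u] by linarith
      then have "?u / 2 * (norm \<xi> powr (- (\<sigma> + s)) * (?P / 2)) \<le> cmod (?v \<xi>)"
        unfolding conjunct2[OF v] using \<delta>0(2)[of \<xi>] le t by (intro mult_mono) (auto simp: \<delta>_def)
      also have "?u / 2 * (norm \<xi> powr (- (\<sigma> + s)) * (?P / 2)) = (t * ?P / 4) * (norm \<xi> powr \<sigma> * norm \<xi> powr (- (\<sigma> + s)))"
        by simp
      also have "norm \<xi> powr \<sigma> * norm \<xi> powr (- (\<sigma> + s)) = norm \<xi> powr (- s)"
        by (simp add: powr_add[symmetric])
      finally show ?thesis .
    qed
    then have "((t * ?P / 4) * norm \<xi> powr (- s))\<^sup>2 \<le> (cmod (?v \<xi>))\<^sup>2" if "norm \<xi> \<le> \<delta>"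
      using that t by (intro power_mono) auto
    moreover have "- (2 * s) = - s + - s" by simp
    then have "norm \<xi> powr (- (2 * s)) = (norm \<xi> powr (- s))\<^sup>2" by (simp only: powr_add power2_eq_square)
    ultimately have "(t * ?P / 4)\<^sup>2 * norm \<xi> powr (- (2 * s)) \<le> (cmod (?v \<xi>))\<^sup>2" if "norm \<xi> \<le> \<delta>"
      using that by (simp only: power_mult_distrib)
    then show "ennreal ((t * ?P / 4)\<^sup>2) * (ennreal (norm \<xi> powr (- (2 * s))) * indicator {0<..\<delta>} (norm \<xi>))
      \<le> ennreal ((cmod (?v \<xi>))\<^sup>2)"
      by (auto simp: indicator_def ennreal_mult'[symmetric] intro!: ennreal_leI)
  qed
  have "\<infinity> = ennreal ((t * ?P / 4)\<^sup>2) * (\<integral>\<^sup>+\<xi>. ennreal (norm (\<xi> :: 'a) powr (- (2 * s))) * indicator {0<..\<delta>} (norm \<xi>) \<partial>lebesgue)"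
    unfolding nn_integral_radial_powr_infinite[OF n \<delta>] using t P by (simp add: ennreal_mult_top)
  also have "\<dots> = (\<integral>\<^sup>+\<xi>. ennreal ((t * ?P / 4)\<^sup>2) * (ennreal (norm (\<xi> :: 'a) powr (- (2 * s))) * indicator {0<..\<delta>} (norm \<xi>)) \<partial>lebesgue)"
    by (intro nn_integral_cmult[symmetric] measurable_completion) simp
  also have "\<dots> \<le> sq_norm ?v" unfolding sq_norm_def by (rule nn_integral_mono_AE[OF low])
  \<comment> \<open>For \<open>w0\<close> merely in \<open>L2\<close> the transform has no pointwise
    bound, so it is removed in norm: a finite norm of the solution would make the velocity term
    square integrable.\<close>
  also have "\<dots> \<le> 2 * sq_norm (wave_hat \<sigma> w0 w1_hat t) + 2 * sq_norm (fourier_L2 w0)"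
  proof (intro sq_norm_bound AE_I2)
    fix \<xi> :: 'a
    have "cmod (complex_of_real (cos (norm \<xi> powr \<sigma> * t)) * fourier_L2 w0 \<xi>) \<le> cmod (fourier_L2 w0 \<xi>)"
      by (simp add: norm_mult mult_left_le_one_le)
    then show "cmod (?v \<xi>) \<le> cmod (wave_hat \<sigma> w0 w1_hat t \<xi>) + cmod (fourier_L2 w0 \<xi>)"
      using norm_triangle_sub[of "?v \<xi>" "wave_hat \<sigma> w0 w1_hat t \<xi>"] by (simp add: wave_hat_eq)
  qed auto
  finally have "sq_norm (wave_hat \<sigma> w0 w1_hat t) = \<infinity>"
    using F by (auto simp: L2_iff top_unique ennreal_mult_eq_top_iff)
  then have "L2_norm (wave_hat \<sigma> w0 w1_hat t) = \<infinity>" by (simp add: L2_norm_eq)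
  then show ?thesis by (simp add: wave_L2_norm_def ennreal_mult_top)
qed

theorem mainTheorem6:
  fixes \<sigma> s :: real
  assumes "\<sigma> \<ge> 1" and "s \<ge> 0"
  shows
    "(2 * s < real CARD('n::finite) \<longrightarrow>
       (\<exists>C>0. \<exists>T>0. \<forall>(w0 :: real^'n \<Rightarrow> complex) w1_hat g.
          w0 \<in> L2 \<and> frac_grad s w1_hat g \<and> g \<in> L2 \<inter> L1 \<longrightarrow>
          (\<forall>t\<ge>T. wave_L2_norm \<sigma> w0 w1_hat t
                   \<le> ennreal (C * growth CARD('n) \<sigma> s t) *
                     (L2_norm w0 + (L2_norm g + L1_norm g))))) \<and>
     (2 * s < real CARD('n) \<longrightarrow>
       (\<forall>(w0 :: real^'n \<Rightarrow> complex) w1_hat g.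
          w0 \<in> L2 \<inter> L1 \<and> frac_grad s w1_hat g \<and> g \<in> L2 \<inter> L11 \<and> total_mass g \<noteq> 0 \<longrightarrow>
          (\<exists>c>0. \<exists>T>0. \<forall>t\<ge>T. wave_L2_norm \<sigma> w0 w1_hat t
                   \<ge> ennreal (c * growth CARD('n) \<sigma> s t * cmod (total_mass g))))) \<and>
     (real CARD('n) \<le> 2 * s \<longrightarrow>
       (\<forall>(w0 :: real^'n \<Rightarrow> complex) w1_hat g.
          w0 \<in> L2 \<and> frac_grad s w1_hat g \<and> g \<in> L11 \<and> total_mass g \<noteq> 0 \<longrightarrow>
          (\<forall>t0>0. \<forall>t\<in>{0<..t0}. wave_L2_norm \<sigma> w0 w1_hat t = \<infinity>)))"
    using wave_upper[OF assms, where 'a="real^'n"] wave_lower[OF assms, where 'a="real^'n"]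
    wave_infinite[OF assms, where 'a="real^'n"]
  by (intro conjI impI allI ballI) (simp_all only: DIM_cart DIM_real mult_1_right, auto)

end
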